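(* If two connected cubic ($3$-regular) simple graphs $G$ and $H$ of order $10$ have the same energy, $E(G)=E(H)$, then their adjacency matrices have the same permanent: $\operatorname{per}(A(G))=\operatorname{per}(A(H))$.
   Context: For a graph $G$ with adjacency matrix $A(G)$ and adjacency eigenvalues $\lambda_1,\dots,\lambda_n$, the energy is $E(G)=\sum_i|\lambda_i|$. The permanent of an $n\times n$ matrix $M=(m_{ij})$ is $\operatorname{per}(M)=\sum_{\sigma\in S_n}\prod_{i=1}^n m_{i\sigma(i)}$. *)

theory Defs
  imports
    "Graph_Theory.Digraph_Component"
    "Jordan_Normal_Form.Char_Poly"
    "HOL.Complex"
begin

text \<open>
  Finite simple graphs are the locale \<open>pair_graph\<close>: an undirected edge between \<open>u\<close> and \<open>v\<close> is
  the pair of arcs \<open>(u, v)\<close> and \<open>(v, u)\<close>, so the degree of a vertex is its out-degree.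
\<close>

definition regular_graph :: "nat \<Rightarrow> 'a pair_pre_digraph \<Rightarrow> bool" where
  "regular_graph d G \<longleftrightarrow> (\<forall>v \<in> pverts G. out_degree (with_proj G) v = d)"

text \<open>The list \<open>vs\<close> enumerates the vertices; it should be distinct with \<open>set vs = pverts G\<close>.\<close>

definition adjacency_mat :: "'a list \<Rightarrow> 'a pair_pre_digraph \<Rightarrow> 'b :: zero_neq_one mat" where
  "adjacency_mat vs G = mat (length vs) (length vs)
     (\<lambda>(i, j). if (vs ! i, vs ! j) \<in> parcs G then 1 else 0)"

text \<open>
  The eigenvalues are taken over the complex numbers and weighted by their algebraic
  multiplicity, so none is lost for an arbitrary square matrix; those of an adjacency matrix of a
  simple graph are real, and there \<open>cmod\<close> is the absolute value.
\<close>

definition graph_energy :: "'a list \<Rightarrow> 'a pair_pre_digraph \<Rightarrow> real" where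
  "graph_energy vs G = (let A = adjacency_mat vs G :: complex mat in
     \<Sum>x | eigenvalue A x. real (Polynomial.order x (char_poly A)) * cmod x)"

text \<open>As for \<^const>\<open>det\<close>, the value on a non-square matrix is \<open>0\<close>.\<close>

definition permanent :: "'a :: comm_semiring_1 mat \<Rightarrow> 'a" where
  "permanent A = (if dim_row A = dim_col A
     then \<Sum>p | p permutes {0..<dim_row A}. \<Prod>i = 0..<dim_row A. A $$ (i, p i)
     else 0)"

end

theory Submission
  imports Defs
begin

text \<open>
  Explore a connected cubic graph from an arbitrary vertex and number the vertices in the order of
  their discovery. Up to the numbering of vertices discovered together, the only freedom lies in which
  vertices discovered earlier are joined to the current one. In order 10 this leaves 639 labelled
  graphs, and explicit relabellings reduce them to 19 representatives. Energy and permanent do not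
  depend on the numbering. For the representatives, row by row Laplace expansion gives the permanent
  and the characteristic polynomial exactly. The latter is a product of square-free integer
  polynomials whose roots are isolated by sign changes at multiples of \<open>1 / 2048\<close>; hence
  2048 times the energy is known up to an error of 10. Whenever two permanents
  differ, these approximations differ by more than 20.
\<close>

text \<open>Numerical bounds cannot prove two energies equal, but only inequalities have to be
  certified: equality of energies serves to exclude pairs with different permanents. This matters,
  since nonisomorphic graphs with exactly equal energy exist. In \<open>cubic_graphs\<close>,
  counted from 0, entries 1 and 17 both have energy 11 + sqrt 17 and permanent 72, and entries 9 and
  18 (the Petersen graph) both have energy 16 and permanent 60.

  Square-free factors are used because a root of even multiplicity causes no sign change. As each
  factor gets as many isolated roots as its degree, the reality of the spectrum comes out of the
  root count.

  The finite checks are evaluated by the simplifier, so cost shapes the definitions: all arithmetic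
  is on integers, and merging after each row leaves at most 252 (10 choose 5) column sets instead of
  10! permutations.\<close>

section \<open>Permanents and determinants\<close>

text \<open>Permutations are grouped by the image \<open>j\<close> of 0;
  \<open>permutation_insert 0 j\<close> reindexes each group by the permutations of the remaining
  indices. Unlike for the determinant, no signs arise.\<close>

lemma permanent_laplace_first_row:
  fixes A :: "'a :: comm_ring_1 mat"
  assumes A: "A \<in> carrier_mat (Suc n) (Suc n)"
  shows "permanent A = (\<Sum>j<Suc n. A $$ (0, j) * permanent (mat_delete A 0 j))"
proof -
  let ?N = "{0..<Suc n}"
  let ?g = "\<lambda>p. \<Prod>i\<in>?N. A $$ (i, p i)"
  have split: "{p. p permutes ?N} = (\<Union>j\<in>?N. {p. p permutes ?N \<and> p 0 = j})"
  proof (intro equalityI subsetI)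
    fix p assume "p \<in> {p. p permutes ?N}"
    then have "p permutes ?N" by simp
    then have "p 0 \<in> ?N" using permutes_in_image[of p ?N 0] by auto
    with \<open>p permutes ?N\<close> show "p \<in> (\<Union>j\<in>?N. {p. p permutes ?N \<and> p 0 = j})" by blast
  qed auto
  have fixed: "(\<Sum>p | p permutes ?N \<and> p 0 = j. ?g p) = A $$ (0, j) * permanent (mat_delete A 0 j)"
    if j: "j < Suc n" for j
  proof -
    have "(\<Sum>p | p permutes ?N \<and> p 0 = j. ?g p)
        = sum ?g (permutation_insert 0 j ` {q. q permutes {0..<n}})"
      using permutation_fix[OF _ j, of 0] by simp
    also have "\<dots> = (\<Sum>q | q permutes {0..<n}. ?g (permutation_insert 0 j q))"
      by (subst sum.reindex[OF permutation_insert_inj_on[OF _ j]]) simp_all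
    also have "\<dots> = (\<Sum>q | q permutes {0..<n}.
        A $$ (0, j) * (\<Prod>i = 0..<n. mat_delete A 0 j $$ (i, q i)))"
    proof (rule sum.cong)
      fix q assume "q \<in> {q. q permutes {0..<n}}"
      then have q: "q permutes {0..<n}" by simp
      have "A $$ (Suc i, permutation_insert 0 j q (Suc i)) = mat_delete A 0 j $$ (i, q i)"
        if "i < n" for i
      proof -
        have "q i < n" using permutes_in_image[OF q, of i] that by simp
        with A that j show ?thesis
          by (auto simp: mat_delete_def permutation_insert_expand)
      qed
      then show "?g (permutation_insert 0 j q)
          = A $$ (0, j) * (\<Prod>i = 0..<n. mat_delete A 0 j $$ (i, q i))"
        by (subst prod.atLeast0_lessThan_Suc_shift) simp
    qed simp
    also have "\<dots> = A $$ (0, j) * permanent (mat_delete A 0 j)"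
      using A by (simp add: permanent_def sum_distrib_left)
    finally show ?thesis .
  qed
  have "permanent A = (\<Sum>p | p permutes ?N. ?g p)"
    using A by (simp add: permanent_def)
  also have "\<dots> = (\<Sum>j\<in>?N. \<Sum>p | p permutes ?N \<and> p 0 = j. ?g p)"
    unfolding split by (rule sum.UNION_disjoint) (auto intro: finite_subset[OF _ finite_permutations[of ?N]])
  also have "\<dots> = (\<Sum>j<Suc n. A $$ (0, j) * permanent (mat_delete A 0 j))"
    unfolding atLeast0LessThan by (intro sum.cong refl, rule fixed[unfolded atLeast0LessThan]) simp
  finally show ?thesis .
qed

text \<open>After reindexing the rows by \<open>p\<close>, the summand of \<open>q\<close> becomes
  that of the conjugate of \<open>q\<close> by \<open>p\<close>, and conjugation is a bijection on
  permutations.\<close>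

lemma permanent_conjugate_permutation:
  fixes A :: "'a :: comm_semiring_1 mat"
  assumes A: "A \<in> carrier_mat n n" and p: "p permutes {0..<n}"
  shows "permanent (mat n n (\<lambda>(i, j). A $$ (p i, p j))) = permanent A"
proof -
  have less: "p i < n" if "i < n" for i using permutes_in_image[OF p, of i] that by simp
  let ?Q = "{q. q permutes {0..<n}}"
  have "permanent (mat n n (\<lambda>(i, j). A $$ (p i, p j)))
      = (\<Sum>q\<in>?Q. \<Prod>i = 0..<n. A $$ (p i, p (q i)))"
    unfolding permanent_def
    by (auto intro!: sum.cong prod.cong simp: less)
  also have "\<dots> = (\<Sum>q\<in>?Q. \<Prod>i = 0..<n. A $$ (p i, (p \<circ> q \<circ> Hilbert_Choice.inv p) (p i)))"
    using permutes_inverses[OF p] by simp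
  also have "\<dots> = (\<Sum>q\<in>?Q. \<Prod>i = 0..<n. A $$ (i, (p \<circ> q \<circ> Hilbert_Choice.inv p) i))"
    by (intro sum.cong refl prod.permute[OF p, unfolded comp_def, symmetric])
  also have "\<dots> = (\<Sum>q\<in>?Q. \<Prod>i = 0..<n. A $$ (i, q i))"
  proof (rule sum.reindex_bij_betw[where h = "\<lambda>q. p \<circ> q \<circ> Hilbert_Choice.inv p" and g = "\<lambda>q. \<Prod>i = 0..<n. A $$ (i, q i)"])
    show "bij_betw (\<lambda>q. p \<circ> q \<circ> Hilbert_Choice.inv p) ?Q ?Q"
      using permutes_inv[OF p] p permutes_inv_o[OF p]
      by (intro bij_betwI[where g = "\<lambda>q. Hilbert_Choice.inv p \<circ> q \<circ> p"])
         (auto intro: permutes_compose simp: o_assoc[symmetric] simp flip: o_assoc)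
  qed
  also have "\<dots> = permanent A" using A by (simp add: permanent_def)
  finally show ?thesis .
qed

text \<open>Injectivity of \<open>p\<close> keeps the diagonal on the diagonal. Rows are permuted
  directly and columns via the transpose; each costs a factor \<open>signof p\<close>, and the two
  cancel.\<close>

lemma char_poly_conjugate_permutation:
  fixes A :: "'a :: comm_ring_1 mat"
  assumes A: "A \<in> carrier_mat n n" and p: "p permutes {0..<n}"
  shows "char_poly (mat n n (\<lambda>(i, j). A $$ (p i, p j))) = char_poly A"
proof -
  have less: "p i < n" if "i < n" for i using permutes_in_image[OF p, of i] that by simp
  let ?C = "char_poly_matrix A"
  let ?R = "mat n n (\<lambda>(i, j). ?C\<^sup>T $$ (p i, j))"
  have C: "?C \<in> carrier_mat n n" using A by simp
  have "char_poly_matrix (mat n n (\<lambda>(i, j). A $$ (p i, p j))) = mat n n (\<lambda>(i, j). ?C $$ (p i, p j))"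
    using A less permutes_inj[OF p]
    by (intro eq_matI) (auto simp: char_poly_matrix_def inj_eq)
  also have "\<dots> = mat n n (\<lambda>(i, j). ?R\<^sup>T $$ (p i, j))"
    using C less by (intro eq_matI) auto
  also have "det \<dots> = signof p * det ?R\<^sup>T"
    by (rule det_permute_rows[OF _ p]) auto
  also have "det ?R\<^sup>T = det ?R" by (rule det_transpose[of _ n]) auto
  also have "det ?R = signof p * det ?C"
    using det_permute_rows[OF transpose_carrier_mat[THEN iffD2, OF C] p] det_transpose[OF C] by simp
  finally show ?thesis by (simp add: char_poly_def sign_def)
qed

text \<open>Expansion always runs along the top row, so every minor that occurs is determined by its
  first row \<open>i\<close> and its surviving columns \<open>cs\<close>.\<close>

definition minor_from :: "(nat \<Rightarrow> nat \<Rightarrow> 'a) \<Rightarrow> nat \<Rightarrow> nat list \<Rightarrow> 'a mat" where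
  "minor_from a i cs = mat (length cs) (length cs) (\<lambda>(r, c). a (i + r) (cs ! c))"

lemma mat_delete_minor_from:
  assumes "k < length cs"
  shows "mat_delete (minor_from a i cs) 0 k = minor_from a (Suc i) (take k cs @ drop (Suc k) cs)"
  using assms by (intro eq_matI) (auto simp: mat_delete_def minor_from_def nth_append min_def)

lemma det_minor_from:
  assumes "cs \<noteq> []"
  shows "det (minor_from a i cs) = (\<Sum>k<length cs.
    (- 1 :: 'a :: comm_ring_1) ^ k * a i (cs ! k) * det (minor_from a (Suc i) (take k cs @ drop (Suc k) cs)))"
proof -
  have "det (minor_from a i cs) = (\<Sum>k<length cs. minor_from a i cs $$ (0, k) * cofactor (minor_from a i cs) 0 k)"
    using assms by (intro laplace_expansion_row) (simp_all add: minor_from_def)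
  also have "\<dots> = (\<Sum>k<length cs. (- 1) ^ k * a i (cs ! k) * det (minor_from a (Suc i) (take k cs @ drop (Suc k) cs)))"
    using assms by (intro sum.cong) (auto simp: cofactor_def mat_delete_minor_from, simp add: minor_from_def)
  finally show ?thesis .
qed

text \<open>The factor \<open>1 ^ k\<close> only copies the shape of \<open>det_minor_from\<close>,
  so that both expansions instantiate one locale.\<close>

lemma permanent_minor_from:
  assumes "cs \<noteq> []"
  shows "permanent (minor_from a i cs) = (\<Sum>k<length cs.
    (1 :: 'a :: comm_ring_1) ^ k * a i (cs ! k) * permanent (minor_from a (Suc i) (take k cs @ drop (Suc k) cs)))"
proof -
  obtain n where n: "length cs = Suc n" using assms by (cases cs) auto
  have "permanent (minor_from a i cs) = (\<Sum>k<Suc n. minor_from a i cs $$ (0, k) * permanent (mat_delete (minor_from a i cs) 0 k))"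
    by (intro permanent_laplace_first_row) (simp_all add: minor_from_def n)
  also have "\<dots> = (\<Sum>k<length cs. 1 ^ k * a i (cs ! k) * permanent (minor_from a (Suc i) (take k cs @ drop (Suc k) cs)))"
    unfolding n by (intro sum.cong) (auto simp: n mat_delete_minor_from, simp add: minor_from_def n)
  finally show ?thesis .
qed

section \<open>Polynomials with isolated real roots\<close>

lemma order_prod_linear:
  fixes zs :: "'a :: field list"
  shows "Polynomial.order x (\<Prod>z\<leftarrow>zs. [:- z, 1:]) = count_list zs x"
proof (induction zs)
  case (Cons z zs)
  have "[:- z, 1:] * (\<Prod>z\<leftarrow>zs. [:- z, 1:]) \<noteq> 0"
    unfolding mult_eq_0_iff prod_list_zero_iff by auto
  moreover have "Polynomial.order x [:- z, 1:] = (if z = x then 1 else 0)"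
    using order_power_n_n[of x 1] by (auto intro: order_0I)
  ultimately show ?case using Cons by (simp add: order_mult del: mult_pCons_left)
qed simp

lemma sum_eigenvalues_eq:
  fixes A :: "complex mat"
  assumes A: "A \<in> carrier_mat n n" and p: "char_poly A = (\<Prod>z\<leftarrow>zs. [:- z, 1:])"
  shows "(\<Sum>x | eigenvalue A x. real (Polynomial.order x (char_poly A)) * f x) = (\<Sum>z\<leftarrow>zs. f z)"
proof -
  have "{x. eigenvalue A x} = set zs"
    unfolding eigenvalue_root_char_poly[OF A] p poly_prod_list prod_list_zero_iff by auto
  \<comment> \<open>A fixed finite superset \<open>S\<close> lets the induction drop an element of
    \<open>zs\<close> without changing the index set.\<close>
  moreover have "(\<Sum>x\<in>S. real (count_list zs x) * f x) = (\<Sum>z\<leftarrow>zs. f z)"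
    if "finite S" "set zs \<subseteq> S" for S
    using that
  proof (induction zs)
    case (Cons z zs)
    have "(\<Sum>x\<in>S. real (count_list (z # zs) x) * f x)
        = (\<Sum>x\<in>S. (if x = z then f x else 0) + real (count_list zs x) * f x)"
      by (intro sum.cong) (auto simp: algebra_simps)
    with Cons show ?case by (simp add: sum.distrib)
  qed simp
  ultimately show ?thesis by (simp add: p order_prod_linear)
qed

lemma monic_eq_prod_linear:
  fixes p :: "'a :: field poly"
  assumes "lead_coeff p = 1" "degree p = length rs" "distinct rs" "\<And>r. r \<in> set rs \<Longrightarrow> poly p r = 0"
  shows "p = (\<Prod>r\<leftarrow>rs. [:- r, 1:])"
  using assms
proof (induction rs arbitrary: p)
  case Nil
  then show ?case by (auto elim: degree_eq_zeroE)
next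
  case (Cons r rs)
  then have "poly p r = 0" by simp
  then obtain q where q: "p = [:- r, 1:] * q" by (auto simp: poly_eq_0_iff_dvd)
  with Cons.prems(1) have "q \<noteq> 0" by auto
  then have "degree p = Suc (degree q)" unfolding q by (subst degree_mult_eq) auto
  moreover have "lead_coeff q = 1" using Cons.prems(1) unfolding q by (simp add: lead_coeff_mult del: mult_pCons_left)
  moreover have "poly q r' = 0" if "r' \<in> set rs" for r'
    using Cons.prems(3) Cons.prems(4)[of r'] that unfolding q by auto
  ultimately have "q = (\<Prod>r\<leftarrow>rs. [:- r, 1:])" using Cons.prems by (intro Cons.IH) auto
  then show ?case by (simp add: q)
qed

text \<open>
  Polynomials as coefficient lists, lowest degree first.
\<close>

fun list_add :: "int list \<Rightarrow> int list \<Rightarrow> int list" where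
  "list_add [] ys = ys"
| "list_add (x # xs) [] = x # xs"
| "list_add (x # xs) (y # ys) = (x + y) # list_add xs ys"

fun list_mult :: "int list \<Rightarrow> int list \<Rightarrow> int list" where
  "list_mult [] ys = []"
| "list_mult (x # xs) ys = list_add (map ((*) x) ys) (0 # list_mult xs ys)"

lemma Poly_list_add: "Poly (list_add xs ys) = Poly xs + Poly ys"
  by (induction xs ys rule: list_add.induct) auto

lemma Poly_map_uminus: "Poly (map uminus xs) = - Poly (xs :: int list)"
  by (induction xs) auto

lemma Poly_map_mult: "Poly (map ((*) x) ys) = Polynomial.smult x (Poly (ys :: int list))"
  by (induction ys) auto

lemma Poly_list_mult: "Poly (list_mult xs ys) = Poly xs * Poly ys"
  by (induction xs ys rule: list_mult.induct) (auto simp: Poly_list_add Poly_map_mult)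

lemma Poly_foldr_list_mult: "Poly (foldr list_mult css [1]) = (\<Prod>cs\<leftarrow>css. Poly cs)"
  by (induction css) (auto simp: Poly_list_mult one_pCons)

lemma coeff_Poly_last: "cs \<noteq> [] \<Longrightarrow> coeff (Poly cs) (length cs - 1) = last cs"
  by (simp add: nth_default_nth last_conv_nth)

text \<open>
  The pair \<open>(N\<^sup>n p(a / N), N\<^sup>n)\<close> for the polynomial \<open>p\<close> with \<open>n\<close> listed coefficients, which keeps the
  evaluation at a rational point within the integers.
\<close>

fun scaled_eval :: "int \<Rightarrow> int \<Rightarrow> int list \<Rightarrow> int \<times> int" where
  "scaled_eval N a [] = (0, 1)"
| "scaled_eval N a (c # cs) = (let (v, w) = scaled_eval N a cs in (c * (N * w) + a * v, N * w))"

definition sign_at :: "int \<Rightarrow> int list \<Rightarrow> int \<Rightarrow> int" where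
  "sign_at N cs a = sgn (fst (scaled_eval N a cs))"

text \<open>
  The polynomial changes sign between \<open>(m - 1) / N\<close> and \<open>(m + 1) / N\<close> for each listed \<open>m\<close>; the gaps
  in the list make these intervals disjoint, so that they account for all roots.
\<close>

definition isolates :: "int \<Rightarrow> int list \<Rightarrow> int list \<Rightarrow> bool" where
  "isolates N cs ms \<longleftrightarrow> length cs = Suc (length ms) \<and> last cs = 1 \<and> sorted_wrt (\<lambda>m m'. m + 2 \<le> m') ms \<and>
     list_all (\<lambda>m. sign_at N cs (m - 1) + sign_at N cs (m + 1) = 0 \<and> sign_at N cs (m + 1) \<noteq> 0) ms"

lemma scaled_eval:
  assumes "N \<noteq> 0"
  shows "snd (scaled_eval N a cs) = N ^ length cs"
    and "real_of_int (fst (scaled_eval N a cs)) = N ^ length cs * poly (of_int_poly (Poly cs)) (a / N)"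
  using assms by (induction cs) (auto simp: case_prod_beta Let_def field_simps of_int_hom.map_poly_pCons_hom)

text \<open>The scaling factor is a power of \<open>N > 0\<close>, so it does not affect the
  sign.\<close>

lemma sgn_poly_eq_sign_at:
  assumes "N > 0"
  shows "sgn (poly (of_int_poly (Poly cs)) (a / N) :: real) = of_int (sign_at N cs a)"
proof -
  have "real_of_int (sign_at N cs a) = sgn (real_of_int (fst (scaled_eval N a cs)))"
    by (simp add: sign_at_def sgn_if)
  also have "\<dots> = sgn (poly (of_int_poly (Poly cs)) (a / N))"
    using assms by (simp add: scaled_eval(2) sgn_mult)
  finally show ?thesis by simp
qed

text \<open>The intermediate value theorem gives a root strictly within \<open>1 / N\<close> of each
  \<open>m / N\<close>. Listed values are at least 2 apart, so these open intervals are disjoint and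
  the roots distinct; their number equals the degree, which forces a monic polynomial to
  split.\<close>

lemma isolates_imp_factorization:
  assumes N: "N > 0" and iso: "isolates N cs ms"
  obtains rs :: "real list" where "of_int_poly (Poly cs) = (\<Prod>r\<leftarrow>rs. [:- r, 1 :: real:])"
    and "list_all2 (\<lambda>r m. \<bar>real_of_int N * r - real_of_int m\<bar> < 1) rs ms"
proof -
  let ?p = "of_int_poly (Poly cs) :: real poly"
  have "\<exists>r::real. \<bar>N * r - m\<bar> < 1 \<and> poly ?p r = 0" if "m \<in> set ms" for m
  proof -
    have "sign_at N cs (m - 1) = - sign_at N cs (m + 1)" "sign_at N cs (m + 1) \<noteq> 0"
      using iso that by (auto simp: isolates_def list_all_iff)
    then have "sgn (poly ?p ((m - 1) / N)) = - sgn (poly ?p ((m + 1) / N))" "sgn (poly ?p ((m + 1) / N)) \<noteq> 0"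
      using sgn_poly_eq_sign_at[OF N, of cs "m - 1"] sgn_poly_eq_sign_at[OF N, of cs "m + 1"] by auto
    then have "poly ?p ((m - 1) / N) * poly ?p ((m + 1) / N) < 0"
      by (auto simp: sgn_if mult_less_0_iff split: if_splits)
    moreover have "(m - 1) / N < (m + 1) / N" using N by (simp add: divide_strict_right_mono)
    ultimately obtain r where r: "(m - 1) / N < r" "r < (m + 1) / N" "poly ?p r = 0"
      using poly_IVT[of "(m - 1) / N" "(m + 1) / N" ?p] by blast
    with N have "\<bar>N * r - m\<bar> < 1" by (simp add: field_simps abs_less_iff)
    with r show ?thesis by blast
  qed
  then obtain root :: "int \<Rightarrow> real" where root: "\<bar>N * root m - m\<bar> < 1" "poly ?p (root m) = 0" if "m \<in> set ms" for m
    by metis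
  have "distinct (map root ms)"
  proof -
    have "root (ms ! i) < root (ms ! j)" if "i < j" "j < length ms" for i j
    proof -
      have "ms ! i + 2 \<le> ms ! j"
        using iso that by (auto simp: isolates_def sorted_wrt_iff_nth_less)
      then have "N * root (ms ! i) < N * root (ms ! j)"
        using root(1)[of "ms ! i"] root(1)[of "ms ! j"] that by auto
      with N show ?thesis by simp
    qed
    then have "sorted_wrt (<) (map root ms)" by (simp add: sorted_wrt_iff_nth_less)
    then show ?thesis by (simp only: strict_sorted_iff)
  qed
  moreover have lc: "coeff ?p (length ms) = 1" 
    using iso coeff_Poly_last[of cs] by (cases "cs = []") (auto simp: isolates_def)
  moreover have deg: "degree ?p = length ms"
  proof (rule antisym)
    show "degree ?p \<le> length ms"
      using iso by (intro degree_le) (auto simp: isolates_def nth_default_beyond)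
    show "length ms \<le> degree ?p" using lc by (intro le_degree) simp
  qed
  ultimately have "?p = (\<Prod>r\<leftarrow>map root ms. [:- r, 1:])"
    using root(2) by (intro monic_eq_prod_linear) auto
  moreover have "list_all2 (\<lambda>r m. \<bar>real_of_int N * r - real_of_int m\<bar> < 1) (map root ms) ms"
    using root(1) by (auto simp: list_all2_conv_all_nth)
  ultimately show ?thesis by (rule that)
qed

text \<open>By the reverse triangle inequality each root contributes an error below 1.\<close>

lemma sum_list_abs_approx:
  fixes rs :: "real list"
  assumes "list_all2 (\<lambda>r m. \<bar>real_of_int N * r - real_of_int m\<bar> < 1) rs ms" and "N > 0"
  shows "\<bar>N * (\<Sum>r\<leftarrow>rs. \<bar>r\<bar>) - real_of_int (\<Sum>m\<leftarrow>ms. \<bar>m\<bar>)\<bar> \<le> length ms"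
  using assms(1)
proof (induction rule: list_all2_induct)
  case (Cons r rs m ms)
  have "\<bar>N * \<bar>r\<bar> - \<bar>m\<bar>\<bar> < 1" 
    using Cons(1) assms(2) abs_triangle_ineq3[of "N * r" "real_of_int m"] by (simp add: abs_mult)
  with Cons show ?case by (simp add: algebra_simps)
qed simp

text \<open>Concatenating the root lists of the factors lists each eigenvalue with its multiplicity,
  because a repeated eigenvalue is a simple root of several factors. All listed roots are real, so
  \<open>cmod\<close> becomes the real absolute value.\<close>

lemma energy_approx:
  fixes A :: "complex mat"
  assumes A: "A \<in> carrier_mat n n" and p: "char_poly A = of_int_poly (\<Prod>(cs, ms)\<leftarrow>fs. Poly cs)"
    and N: "N > 0" and iso: "list_all (\<lambda>(cs, ms). isolates N cs ms) fs"
  shows "\<bar>N * (\<Sum>x | eigenvalue A x. real (Polynomial.order x (char_poly A)) * cmod x)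
           - real_of_int (\<Sum>m\<leftarrow>concat (map snd fs). \<bar>m\<bar>)\<bar> \<le> length (concat (map snd fs))"
proof -
  interpret real_poly_hom: map_poly_comm_ring_hom complex_of_real ..
  have "\<exists>rs :: real list. of_int_poly (\<Prod>(cs, ms)\<leftarrow>fs. Poly cs) = (\<Prod>r\<leftarrow>rs. [:- r, 1 :: real:]) \<and>
      list_all2 (\<lambda>r m. \<bar>real_of_int N * r - real_of_int m\<bar> < 1) rs (concat (map snd fs))"
    using iso
  proof (induction fs)
    case (Cons f fs)
    obtain cs ms where f: "f = (cs, ms)" by (cases f)
    with Cons.prems have "isolates N cs ms" by simp
    then obtain rs :: "real list" where "of_int_poly (Poly cs) = (\<Prod>r\<leftarrow>rs. [:- r, 1 :: real:])"
      and "list_all2 (\<lambda>r m. \<bar>real_of_int N * r - real_of_int m\<bar> < 1) rs ms"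
      by (rule isolates_imp_factorization[OF N])
    moreover obtain rs' :: "real list" where "of_int_poly (\<Prod>(cs, ms)\<leftarrow>fs. Poly cs) = (\<Prod>r\<leftarrow>rs'. [:- r, 1 :: real:])"
      and "list_all2 (\<lambda>r m. \<bar>real_of_int N * r - real_of_int m\<bar> < 1) rs' (concat (map snd fs))"
      using Cons by auto
    ultimately show ?case
      by (intro exI[of _ "rs @ rs'"]) (auto simp: f of_int_poly_hom.hom_mult intro: list_all2_appendI)
  qed auto
  then obtain rs :: "real list" where rs: "of_int_poly (\<Prod>(cs, ms)\<leftarrow>fs. Poly cs) = (\<Prod>r\<leftarrow>rs. [:- r, 1 :: real:])"
    and approx: "list_all2 (\<lambda>r m. \<bar>real_of_int N * r - real_of_int m\<bar> < 1) rs (concat (map snd fs))" by blast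
  \<comment> \<open>Sign changes live over the reals and eigenvalues over the complex numbers; the
    integer polynomial is sent to the latter through the former.\<close>
  have "char_poly A = map_poly complex_of_real (of_int_poly (\<Prod>(cs, ms)\<leftarrow>fs. Poly cs))"
    unfolding p by (subst map_poly_map_poly) (simp_all add: o_def)
  also have "\<dots> = (\<Prod>z\<leftarrow>map complex_of_real rs. [:- z, 1:])"
    unfolding rs by (induction rs)
      (simp_all add: real_poly_hom.hom_mult of_real_hom.map_poly_pCons_hom del: mult_pCons_left)
  finally have "(\<Sum>x | eigenvalue A x. real (Polynomial.order x (char_poly A)) * cmod x) = (\<Sum>r\<leftarrow>rs. \<bar>r\<bar>)"
    using sum_eigenvalues_eq[OF A, of "map complex_of_real rs" cmod] by (simp add: o_def)
  then show ?thesis using sum_list_abs_approx[OF approx N] by simp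
qed

section \<open>Laplace expansion by rows\<close>

text \<open>
  The Boolean is the parity of the position of the removed column, that is, the sign of the cofactor.
\<close>

fun remove_column :: "nat \<Rightarrow> nat list \<Rightarrow> (bool \<times> nat list) option" where
  "remove_column c [] = None"
| "remove_column c (d # ds) = (if c = d then Some (False, ds) else
     (case remove_column c ds of None \<Rightarrow> None | Some (b, es) \<Rightarrow> Some (\<not> b, d # es)))"

lemma remove_column_nth:
  assumes "distinct cs" "k < length cs"
  shows "remove_column (cs ! k) cs = Some (odd k, take k cs @ drop (Suc k) cs)"
  using assms
proof (induction cs arbitrary: k)
  case (Cons c cs)
  then show ?case by (cases k) auto
qed simp

lemma remove_column_eq_None_iff: "remove_column c cs = None \<longleftrightarrow> c \<notin> set cs"
  by (induction cs) (auto split: option.splits)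

fun lex_before :: "nat list \<Rightarrow> nat list \<Rightarrow> bool" where
  "lex_before (c # cs) (d # ds) = (if c = d then lex_before cs ds else c < d)"
| "lex_before _ _ = False"

text \<open>
  A state is a list of terms \<open>(cs, q)\<close> standing for \<open>q\<close> times the minor on the remaining rows and the
  columns \<open>cs\<close>. Merging terms with the same columns after each row keeps the expansion small. The
  order of the terms only ensures that equal columns meet; correctness does not depend on it.
\<close>

fun merge_states :: "('c \<Rightarrow> 'c \<Rightarrow> 'c) \<Rightarrow> (nat list \<times> 'c) list \<Rightarrow> (nat list \<times> 'c) list \<Rightarrow> (nat list \<times> 'c) list" where
  "merge_states pl [] ys = ys"
| "merge_states pl (x # xs) [] = x # xs"
| "merge_states pl ((cs, p) # xs) ((ds, q) # ys) =
     (if cs = ds then (cs, pl p q) # merge_states pl xs ys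
      else if lex_before cs ds then (cs, p) # merge_states pl xs ((ds, q) # ys)
      else (ds, q) # merge_states pl ((cs, p) # xs) ys)"

fun expand_column :: "('c \<Rightarrow> 'c) \<Rightarrow> nat \<Rightarrow> ('c \<Rightarrow> 'c) \<Rightarrow> (nat list \<times> 'c) list \<Rightarrow> (nat list \<times> 'c) list" where
  "expand_column neg c f [] = []"
| "expand_column neg c f ((cs, q) # st) =
     (case remove_column c cs of None \<Rightarrow> expand_column neg c f st
      | Some (b, ds) \<Rightarrow> (ds, if b then neg (f q) else f q) # expand_column neg c f st)"

text \<open>A row is given by its nonzero entries only, each encoded by its action \<open>f\<close>
  on coefficients. For a cubic graph this means 3 branches per row for the permanent and 4 for the
  characteristic polynomial.\<close>

fun expand_row :: "('c \<Rightarrow> 'c \<Rightarrow> 'c) \<Rightarrow> ('c \<Rightarrow> 'c) \<Rightarrow> (nat \<times> ('c \<Rightarrow> 'c)) list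
    \<Rightarrow> (nat list \<times> 'c) list \<Rightarrow> (nat list \<times> 'c) list" where
  "expand_row pl neg [] st = []"
| "expand_row pl neg ((c, f) # fs) st =
     merge_states pl (expand_column neg c f st) (expand_row pl neg fs st)"

fun expand_rows :: "('c \<Rightarrow> 'c \<Rightarrow> 'c) \<Rightarrow> ('c \<Rightarrow> 'c) \<Rightarrow> (nat \<times> ('c \<Rightarrow> 'c)) list list
    \<Rightarrow> (nat list \<times> 'c) list \<Rightarrow> (nat list \<times> 'c) list" where
  "expand_rows pl neg [] st = st"
| "expand_rows pl neg (fs # fss) st = expand_rows pl neg fss (expand_row pl neg fs st)"

text \<open>One soundness proof covers determinants (\<open>s = -1\<close>) and permanents
  (\<open>s = 1\<close>). \<open>E i cs\<close> is the minor on the rows from \<open>i\<close> on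
  and the columns \<open>cs\<close>; \<open>\<phi>\<close> interprets computed coefficients in the
  ring.\<close>

locale laplace_expansion =
  fixes E :: "nat \<Rightarrow> nat list \<Rightarrow> 'a :: comm_ring_1" and a :: "nat \<Rightarrow> nat \<Rightarrow> 'a" and s :: 'a
    and \<phi> :: "'c \<Rightarrow> 'a" and pl :: "'c \<Rightarrow> 'c \<Rightarrow> 'c" and neg :: "'c \<Rightarrow> 'c"
  assumes laplace: "cs \<noteq> [] \<Longrightarrow>
      E i cs = (\<Sum>k<length cs. s ^ k * a i (cs ! k) * E (Suc i) (take k cs @ drop (Suc k) cs))"
    and sign: "s * s = 1"
    and \<phi>_add: "\<phi> (pl p q) = \<phi> p + \<phi> q"
    and \<phi>_neg: "\<phi> (neg p) = s * \<phi> p"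
begin

definition state_value :: "nat \<Rightarrow> (nat list \<times> 'c) list \<Rightarrow> 'a" where
  "state_value i st = (\<Sum>(cs, q)\<leftarrow>st. \<phi> q * E i cs)"

definition column_term :: "nat \<Rightarrow> nat list \<Rightarrow> nat \<Rightarrow> 'a" where
  "column_term i cs c = (case remove_column c cs of None \<Rightarrow> 0
     | Some (b, ds) \<Rightarrow> (if b then s else 1) * a i c * E (Suc i) ds)"

definition represents_row :: "nat \<Rightarrow> (nat \<times> ('c \<Rightarrow> 'c)) list \<Rightarrow> bool" where
  "represents_row i fs \<longleftrightarrow> distinct (map fst fs) \<and> (\<forall>(c, f)\<in>set fs. \<forall>q. \<phi> (f q) = a i c * \<phi> q) \<and>
     (\<forall>c. c \<notin> fst ` set fs \<longrightarrow> a i c = 0)"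

lemma s_power: "s ^ k = (if odd k then s else 1)"
proof (induction k)
  case (Suc k)
  then show ?case using sign by auto
qed simp

text \<open>Laplace expansion sums over positions in \<open>cs\<close>, the program over listed
  entries. Columns of \<open>cs\<close> that are not listed have entry 0, and listed columns already
  removed contribute 0.\<close>

lemma laplace_column_terms:
  assumes "distinct cs" "cs \<noteq> []" "represents_row i fs"
  shows "E i cs = (\<Sum>(c, f)\<leftarrow>fs. column_term i cs c)"
proof -
  have "E i cs = (\<Sum>k<length cs. column_term i cs (cs ! k))"
    unfolding laplace[OF assms(2)]
    by (intro sum.cong) (auto simp: column_term_def remove_column_nth[OF assms(1)] s_power)
  also have "\<dots> = (\<Sum>c\<in>set cs. column_term i cs c)"
    using assms(1) by (intro sum.reindex_bij_betw bij_betw_nth) auto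
  also have "\<dots> = (\<Sum>c\<in>fst ` set fs. column_term i cs c)"
  proof (rule sum.mono_neutral_cong)
    fix c assume "c \<in> set cs - fst ` set fs"
    with assms(3) have "a i c = 0" by (auto simp: represents_row_def)
    then show "column_term i cs c = 0" by (auto simp: column_term_def split: option.splits)
  next
    fix c assume "c \<in> fst ` set fs - set cs"
    then show "column_term i cs c = 0" by (simp add: column_term_def flip: remove_column_eq_None_iff)
  qed auto
  also have "\<dots> = (\<Sum>c\<leftarrow>map fst fs. column_term i cs c)"
    using assms(3) by (subst sum_list_distinct_conv_sum_set) (auto simp: represents_row_def)
  also have "\<dots> = (\<Sum>(c, f)\<leftarrow>fs. column_term i cs c)"
    by (simp add: o_def case_prod_unfold)
  finally show ?thesis .
qed

lemma state_value_merge: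
  "state_value i (merge_states pl st st') = state_value i st + state_value i st'"
proof -
  have "pl' = pl \<Longrightarrow> state_value i (merge_states pl' st st') = state_value i st + state_value i st'" for pl'
    by (induction pl' st st' rule: merge_states.induct)
       (auto simp: state_value_def \<phi>_add algebra_simps)
  then show ?thesis by simp
qed

lemma state_value_expand_column:
  assumes "\<And>q. \<phi> (f q) = a i c * \<phi> q"
  shows "state_value (Suc i) (expand_column neg c f st) = (\<Sum>(cs, q)\<leftarrow>st. \<phi> q * column_term i cs c)"
  by (induction st rule: list.induct)
     (auto simp: state_value_def column_term_def \<phi>_neg assms algebra_simps split: option.splits)

lemma state_value_expand_row:
  assumes fs: "represents_row i fs" and st: "\<And>cs q. (cs, q) \<in> set st \<Longrightarrow> distinct cs \<and> cs \<noteq> []"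
  shows "state_value (Suc i) (expand_row pl neg fs st) = state_value i st"
proof -
  \<comment> \<open>Dropping an entry destroys the completeness of the row demanded by
    \<open>represents_row\<close>, so the induction assumes only that each \<open>f\<close> acts as
    its entry.\<close>
  have "state_value (Suc i) (expand_row pl neg fs st)
      = (\<Sum>(c, f)\<leftarrow>fs. \<Sum>(cs, q)\<leftarrow>st. \<phi> q * column_term i cs c)"
    if "\<forall>(c, f)\<in>set fs. \<forall>q. \<phi> (f q) = a i c * \<phi> q" for fs
    using that
  proof (induction fs)
    case Nil
    then show ?case by (simp add: state_value_def)
  next
    case (Cons x fs)
    then show ?case by (cases x) (simp add: state_value_merge state_value_expand_column)
  qed
  also have "(\<Sum>(c, f)\<leftarrow>fs. \<Sum>(cs, q)\<leftarrow>st. \<phi> q * column_term i cs c)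
      = (\<Sum>(cs, q)\<leftarrow>st. \<Sum>(c, f)\<leftarrow>fs. \<phi> q * column_term i cs c)"
    unfolding case_prod_unfold by (induction st) (simp_all add: sum_list_addf)
  also have "\<dots> = state_value i st"
    unfolding state_value_def
  proof (rule arg_cong[of _ _ sum_list], rule map_cong[OF refl], clarify)
    fix cs q assume "(cs, q) \<in> set st"
    with st have "E i cs = (\<Sum>(c, f)\<leftarrow>fs. column_term i cs c)"
      by (intro laplace_column_terms[OF _ _ fs]) auto
    then show "(\<Sum>(c, f)\<leftarrow>fs. \<phi> q * column_term i cs c) = \<phi> q * E i cs"
      by (simp add: case_prod_unfold sum_list_const_mult)
  qed
  finally show ?thesis using fs by (simp add: represents_row_def)
qed

text \<open>The invariant that as many columns as rows remain; it supplies the condition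
  \<open>cs \<noteq> []\<close> of the Laplace expansion.\<close>

definition columns_left :: "nat \<Rightarrow> (nat list \<times> 'c) list \<Rightarrow> bool" where
  "columns_left n st \<longleftrightarrow> (\<forall>(cs, q)\<in>set st. distinct cs \<and> length cs = n)"

lemma columns_left_expand_column:
  assumes "columns_left (Suc n) st"
  shows "columns_left n (expand_column neg c f st)"
  using assms
proof (induction st)
  case (Cons x st)
  obtain cs q where x: "x = (cs, q)" by (cases x)
  have "remove_column c cs = Some (b, ds) \<Longrightarrow> distinct ds \<and> length ds = n" for b ds
  proof -
    assume rem: "remove_column c cs = Some (b, ds)"
    then have "c \<in> set cs" using remove_column_eq_None_iff[of c cs] by auto
    then obtain k where "k < length cs" "c = cs ! k" by (auto simp: in_set_conv_nth)
    with rem Cons.prems show ?thesis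
      using distinct_take[of cs k] distinct_drop[of cs "Suc k"] set_take_disj_set_drop_if_distinct[of cs k "Suc k"]
      by (auto simp: columns_left_def x remove_column_nth)
  qed
  with Cons show ?case by (auto simp: columns_left_def x split: option.splits)
qed (simp add: columns_left_def)

lemma columns_left_merge:
  "columns_left n st \<Longrightarrow> columns_left n st' \<Longrightarrow> columns_left n (merge_states pl st st')"
  by (induction pl st st' rule: merge_states.induct) (auto simp: columns_left_def)

lemma columns_left_expand_row:
  "columns_left (Suc n) st \<Longrightarrow> columns_left n (expand_row pl neg fs st)"
proof (induction fs)
  case Nil
  then show ?case by (simp add: columns_left_def)
next
  case (Cons x fs)
  then show ?case by (cases x) (simp add: columns_left_merge columns_left_expand_column)
qed

lemma state_value_expand_rows:
  assumes "\<And>k. k < length fss \<Longrightarrow> represents_row (i + k) (fss ! k)" and "columns_left (length fss) st"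
  shows "state_value (i + length fss) (expand_rows pl neg fss st) = state_value i st"
  using assms
proof (induction fss arbitrary: i st)
  case (Cons fs fss)
  have "represents_row i fs" using Cons.prems(1)[of 0] by simp
  have "state_value (i + length (fs # fss)) (expand_rows pl neg (fs # fss) st)
      = state_value (Suc i) (expand_row pl neg fs st)"
    using Cons.prems(1)[of "Suc _"] columns_left_expand_row[of _ st fs] Cons.prems(2) Cons.IH[of "Suc i"] by simp
  also have "\<dots> = state_value i st"
    using Cons.prems(1)[of 0] Cons.prems(2)
    by (intro state_value_expand_row) (auto simp: columns_left_def)
  finally show ?case .
qed simp

text \<open>Expansion preserves the value of the state; once the rows are used up, the empty minor
  is 1 and the value is the coefficient of the one remaining term.\<close>

lemma expand_rows_eq:
  assumes "\<And>k. k < length fss \<Longrightarrow> represents_row k (fss ! k)" and "\<phi> e = 1" and "E (length fss) [] = 1"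
    and "expand_rows pl neg fss [([0..<length fss], e)] = [([], q)]"
  shows "E 0 [0..<length fss] = \<phi> q"
  using state_value_expand_rows[of fss 0 "[([0..<length fss], e)]"] assms
  by (simp add: state_value_def columns_left_def)

end

definition neighbour_mat :: "nat list list \<Rightarrow> 'a :: zero_neq_one mat" where
  "neighbour_mat ls = mat (length ls) (length ls) (\<lambda>(i, j). if j \<in> set (ls ! i) then 1 else 0)"

definition permanent_rows :: "nat list list \<Rightarrow> (nat \<times> (int \<Rightarrow> int)) list list" where
  "permanent_rows ls = map (map (\<lambda>j. (j, id))) ls"

text \<open>For the matrix \<open>x I - A\<close>, multiplication by \<open>x\<close> prepends a 0
  to a coefficient list and multiplication by -1 negates it, so no polynomial products are
  computed.\<close>

definition char_poly_rows :: "nat list list \<Rightarrow> (nat \<times> (int list \<Rightarrow> int list)) list list" where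
  "char_poly_rows ls = map (\<lambda>(i, l). (i, (#) 0) # map (\<lambda>j. (j, map uminus)) l) (zip [0..<length ls] ls)"

lemma permanent_neighbour_mat:
  assumes "list_all distinct ls"
    and "expand_rows (+) id (permanent_rows ls) [([0..<length ls], 1)] = [([], p)]"
  shows "permanent (neighbour_mat ls :: int mat) = p"
proof -
  let ?a = "\<lambda>i j. if j \<in> set (ls ! i) then 1 else 0 :: int"
  interpret laplace_expansion "\<lambda>i cs. permanent (minor_from ?a i cs)" ?a 1 "\<lambda>p. p" "(+)" id
    by unfold_locales (simp_all add: permanent_minor_from)
  have "permanent (minor_from ?a 0 [0..<length (permanent_rows ls)]) = p"
  proof (rule expand_rows_eq)
    fix k assume "k < length (permanent_rows ls)"
    with assms(1) show "represents_row k (permanent_rows ls ! k)"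
      by (auto simp: represents_row_def permanent_rows_def o_def list_all_length image_iff)
  qed (use assms(2) in \<open>simp_all add: permanent_rows_def permanent_def minor_from_def\<close>)
  moreover have "minor_from ?a 0 [0..<length (permanent_rows ls)] = neighbour_mat ls"
    by (auto simp: minor_from_def neighbour_mat_def permanent_rows_def)
  ultimately show ?thesis by simp
qed

lemma char_poly_neighbour_mat:
  assumes "list_all (\<lambda>(i, l). distinct (i # l)) (zip [0..<length ls] ls)"
    and "expand_rows list_add (map uminus) (char_poly_rows ls) [([0..<length ls], [1])] = [([], q)]"
  shows "char_poly (neighbour_mat ls :: int mat) = Poly q"
proof -
  \<comment> \<open>The two summands mirror those of \<open>char_poly_matrix\<close>. At most one is
    nonzero, since no vertex lists itself as a neighbour.\<close>
  let ?a = "\<lambda>i j. (if i = j then [:0, 1:] else 0) + (if j \<in> set (ls ! i) then -1 else 0) :: int poly"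
  interpret laplace_expansion "\<lambda>i cs. det (minor_from ?a i cs)" ?a "- 1" Poly list_add "map uminus"
    by unfold_locales (simp_all add: det_minor_from Poly_list_add Poly_map_uminus)
  have len: "length (char_poly_rows ls) = length ls" by (simp add: char_poly_rows_def)
  have "det (minor_from ?a 0 [0..<length (char_poly_rows ls)]) = Poly q"
  proof (rule expand_rows_eq)
    fix k assume "k < length (char_poly_rows ls)"
    then have k: "k < length ls" by (simp add: len)
    then have "distinct (k # ls ! k)" using assms(1) by (auto simp: list_all_length)
    with k show "represents_row k (char_poly_rows ls ! k)"
      by (auto simp: represents_row_def char_poly_rows_def o_def Poly_map_uminus image_image)
  qed (use assms(2) in \<open>simp_all add: len minor_from_def one_pCons\<close>)
  moreover have "minor_from ?a 0 [0..<length (char_poly_rows ls)] = char_poly_matrix (neighbour_mat ls)"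
    by (intro eq_matI) (auto simp: minor_from_def neighbour_mat_def char_poly_matrix_def len one_pCons)
  ultimately show ?thesis by (simp add: char_poly_def)
qed

section \<open>Exploration of connected regular graphs\<close>

text \<open>
  An exploration of a graph numbers the vertices in the order of their discovery. Its state
  \<open>(ls, Ks)\<close> consists of the full neighbour lists \<open>ls\<close> of the processed vertices and, for each vertex
  that is discovered but not yet processed, the list of its processed neighbours. When vertex \<open>i\<close> is
  processed, \<open>attach\<close> joins it to \<open>r\<close> further vertices: to some of those numbered from \<open>j\<close> on, which
  own the lists \<open>Ks\<close>, and otherwise to newly discovered ones, which get the next numbers.
\<close>

fun attach :: "nat \<Rightarrow> nat \<Rightarrow> nat \<Rightarrow> nat \<Rightarrow> nat list list \<Rightarrow> (nat list \<times> nat list list) list" where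
  "attach d i j 0 Ks = [([], Ks)]"
| "attach d i j (Suc r) [] = [([j..<j + Suc r], replicate (Suc r) [i])]"
| "attach d i j (Suc r) (K # Ks) =
     (if length K < d then map (\<lambda>(S, Ks'). (j # S, (i # K) # Ks')) (attach d i (Suc j) r Ks) else []) @
     map (\<lambda>(S, Ks'). (S, K # Ks')) (attach d i (Suc j) (Suc r) Ks)"

text \<open>The current vertex has number \<open>length ls\<close>, so
  \<open>Suc (length ls) + length Ks'\<close> vertices are now discovered; hence the strict bound.
  An empty queue has no extension, as it means that a whole component is exhausted.\<close>

fun extend :: "nat \<Rightarrow> nat \<Rightarrow> nat list list \<times> nat list list \<Rightarrow> (nat list list \<times> nat list list) list" where
  "extend d n (ls, []) = []"
| "extend d n (ls, K # Ks) =
     filter (\<lambda>(ls', Ks'). length ls + length Ks' < n)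
       (map (\<lambda>(S, Ks'). (ls @ [K @ S], Ks')) (attach d (length ls) (Suc (length ls)) (d - length K) Ks))"

fun levels :: "nat \<Rightarrow> nat \<Rightarrow> nat \<Rightarrow> (nat list list \<times> nat list list) list" where
  "levels d n 0 = [([], [[]])]"
| "levels d n (Suc k) = concat (map (extend d n) (levels d n k))"

lemma attach_join:
  assumes "(S, Ks') \<in> set (attach d i (Suc j) r Ks)" "length K < d"
  shows "(j # S, (i # K) # Ks') \<in> set (attach d i j (Suc r) (K # Ks))"
  using assms by force

lemma attach_skip:
  assumes "(S, Ks') \<in> set (attach d i (Suc j) (Suc r) Ks)"
  shows "(S, K # Ks') \<in> set (attach d i j (Suc r) (K # Ks))"
  using assms by force

text \<open>\<open>P\<close> marks the queued vertices that are truly adjacent to the current one.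
  Following it through the queue (join if \<open>P\<close> holds, skip otherwise) reaches this
  outcome, with the missing neighbours newly discovered.\<close>

lemma attach_complete:
  assumes "length (filter P [j..<j + length Ks]) \<le> r"
    and "\<And>k. k < length Ks \<Longrightarrow> P (j + k) \<Longrightarrow> length (Ks ! k) < d"
  shows "(filter P [j..<j + length Ks] @ [j + length Ks..<j + length Ks + (r - length (filter P [j..<j + length Ks]))],
          map (\<lambda>k. if P (j + k) then i # Ks ! k else Ks ! k) [0..<length Ks]
            @ replicate (r - length (filter P [j..<j + length Ks])) [i]) \<in> set (attach d i j r Ks)"
  using assms
proof (induction Ks arbitrary: j r)
  case Nil
  then show ?case by (cases r) auto
next
  case (Cons K Ks)
  have upt: "[j..<j + length (K # Ks)] = j # [Suc j..<Suc j + length Ks]"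
    using upt_conv_Cons[of j "j + Suc (length Ks)"] by simp
  have shift: "map (\<lambda>k. if P (j + k) then i # (K # Ks) ! k else (K # Ks) ! k) [0..<length (K # Ks)]
    = (if P j then i # K else K) # map (\<lambda>k. if P (Suc j + k) then i # Ks ! k else Ks ! k) [0..<length Ks]"
    unfolding length_Cons upt_conv_Cons[OF zero_less_Suc] map_Suc_upt[symmetric] by simp
  have small: "length (Ks ! k) < d" if "k < length Ks" "P (Suc j + k)" for k
    using Cons.prems(2)[of "Suc k"] that by simp
  let ?F = "filter P [Suc j..<Suc j + length Ks]"
  show ?case
  proof (cases "P j")
    case True
    with Cons.prems(1) obtain r' where r: "r = Suc r'" and le: "length ?F \<le> r'"
      unfolding upt by (cases r) auto
    have "length K < d" using Cons.prems(2)[of 0] True by simp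
    with True attach_join[OF Cons.IH[OF le small]] show ?thesis
      unfolding upt shift r by (simp del: upt_Suc attach.simps)
  next
    case False
    with Cons.prems(1) have le: "length ?F \<le> r" unfolding upt by simp
    show ?thesis
    proof (cases r)
      case 0
      \<comment> \<open>At \<open>r = 0\<close>, \<open>attach\<close> stops without visiting the
        rest of the queue, so no vertex there may satisfy \<open>P\<close>.\<close>
      with le have "\<forall>x\<in>set [Suc j..<Suc j + length Ks]. \<not> P x"
        unfolding filter_empty_conv[symmetric] by simp
      then have none: "\<not> P (Suc j + k)" if "k < length Ks" for k
        using that by (simp del: upt_Suc)
      have "map (\<lambda>k. if P (Suc j + k) then i # Ks ! k else Ks ! k) [0..<length Ks] = map ((!) Ks) [0..<length Ks]"
        using none by (intro map_cong) auto
      with 0 le False show ?thesis unfolding upt shift by (simp add: map_nth)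
    next
      case (Suc r')
      with False attach_skip[OF Cons.IH[OF le small, unfolded Suc]] show ?thesis
        unfolding upt shift Suc by (simp del: upt_Suc attach.simps)
    qed
  qed
qed

text \<open>Connectedness is phrased by closed vertex sets because an emptied queue yields exactly
  such a set.\<close>

locale connected_regular =
  fixes V :: "'a set" and N :: "'a \<Rightarrow> 'a set" and d :: nat
  assumes finite_V: "finite V" and V_nonempty: "V \<noteq> {}"
    and N_subset: "v \<in> V \<Longrightarrow> N v \<subseteq> V"
    and card_N: "v \<in> V \<Longrightarrow> card (N v) = d"
    and N_sym: "w \<in> N v \<Longrightarrow> v \<in> N w"
    and N_irrefl: "v \<notin> N v"
    and connected: "S \<subseteq> V \<Longrightarrow> S \<noteq> {} \<Longrightarrow> (\<And>v. v \<in> S \<Longrightarrow> N v \<subseteq> S) \<Longrightarrow> S = V"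
begin

text \<open>Ties an abstract state to the graph: number \<open>k\<close> stands for the vertex
  \<open>us ! k\<close>, and the numbers from \<open>length ls\<close> on form the queue.\<close>

definition explored :: "'a list \<Rightarrow> nat list list \<Rightarrow> nat list list \<Rightarrow> bool" where
  "explored us ls Ks \<longleftrightarrow> us \<noteq> [] \<and> distinct us \<and> set us \<subseteq> V \<and> length us = length ls + length Ks \<and>
     (\<forall>k<length ls. N (us ! k) = (!) us ` set (ls ! k) \<and> set (ls ! k) \<subseteq> {..<length us}) \<and>
     (\<forall>j<length Ks. distinct (Ks ! j) \<and>
        set (Ks ! j) = {k. k < length ls \<and> us ! k \<in> N (us ! (length ls + j))})"

lemma finite_N: "v \<in> V \<Longrightarrow> finite (N v)"
  using N_subset finite_V by (rule finite_subset)

lemma N_commute: "v \<in> N w \<longleftrightarrow> w \<in> N v"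
  by (rule iffI; rule N_sym)

text \<open>The neighbours of the current vertex \<open>v\<close> split into processed ones
  (\<open>K\<close>), queued ones (\<open>S\<close>) and undiscovered ones (\<open>ws\<close>). By
  regularity the last number \<open>d - length K - length S\<close>, just as many as
  \<open>attach\<close> creates.\<close>

lemma explored_step:
  assumes ex: "explored us ls (K # Ks)"
  shows "\<exists>us' ls' Ks'. explored us' ls' Ks' \<and> length ls' = Suc (length ls) \<and>
    (ls', Ks') \<in> set (extend d (card V) (ls, K # Ks))"
proof -
  define i m v where "i = length ls" and "m = length us" and "v = us ! i"
  define S where "S = filter (\<lambda>k. us ! k \<in> N v) [Suc i..<Suc i + length Ks]"
  have dist: "distinct us" and sub: "set us \<subseteq> V" and m: "m = Suc i + length Ks"
    using ex by (auto simp: explored_def i_def m_def)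
  have rows: "N (us ! k) = (!) us ` set (ls ! k)" "set (ls ! k) \<subseteq> {..<m}" if "k < i" for k
    using ex that unfolding explored_def i_def m_def by blast+
  have K: "distinct K" "set K = {k. k < i \<and> us ! k \<in> N v}"
    using ex by (auto simp: explored_def i_def v_def)
  have Ks: "distinct (Ks ! j)" "set (Ks ! j) = {k. k < i \<and> us ! k \<in> N (us ! (Suc i + j))}"
    if "j < length Ks" for j
    using ex that by (force simp: explored_def i_def)+
  have inV: "us ! k \<in> V" if "k < m" for k using sub that by (auto simp: m_def)
  have v: "v \<in> V" using inV m by (simp add: v_def)
  \<comment> \<open>Any order of the new vertices will do: \<open>attach\<close> merely gives them
    consecutive numbers.\<close>
  obtain ws where ws: "distinct ws" "set ws = N v - set us"
    using finite_distinct_list[of "N v - set us"] finite_N[OF v] by auto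
  have inj: "inj_on ((!) us) A" if "A \<subseteq> {..<m}" for A
    using dist that by (auto simp: inj_on_def m_def nth_eq_iff_index_eq subset_iff)
  have setS: "set S = {k. Suc i \<le> k \<and> k < m \<and> us ! k \<in> N v}" by (auto simp: S_def m)
  have "distinct S" by (simp add: S_def)
  have met: "N v \<inter> set us = (!) us ` (set K \<union> set S)"
  proof (intro equalityI subsetI)
    fix w assume w: "w \<in> N v \<inter> set us"
    then obtain k where k: "k < m" "w = us ! k" by (auto simp: in_set_conv_nth m_def)
    with w N_irrefl[of v] have "k \<noteq> i" by (auto simp: v_def)
    with w k show "w \<in> (!) us ` (set K \<union> set S)" by (auto simp: K(2) setS)
  qed (use m in \<open>auto simp: K(2) setS intro!: nth_mem simp flip: m_def\<close>)
  have "card ((!) us ` (set K \<union> set S)) = length K + length S"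
  proof -
    have "set K \<union> set S \<subseteq> {..<m}" by (auto simp: K(2) setS m)
    moreover have "set K \<inter> set S = {}" by (auto simp: K(2) setS)
    ultimately show ?thesis
      using K(1) \<open>distinct S\<close> by (simp add: card_image[OF inj] card_Un_disjoint distinct_card)
  qed
  moreover have "card (N v) = card (N v \<inter> set us) + card (N v - set us)"
    using finite_N[OF v] by (rule card_Int_Diff)
  ultimately have count: "d = length K + length S + length ws"
    using card_N[OF v] distinct_card[OF ws(1)] ws(2) met by simp
  \<comment> \<open>A queued neighbour of \<open>v\<close> has \<open>v\<close> as a neighbour not
    yet recorded, so its recorded list is still short of \<open>d\<close>.\<close>
  have small: "length (Ks ! k) < d" if k: "k < length Ks" "us ! (Suc i + k) \<in> N v" for k
  proof -
    let ?u = "us ! (Suc i + k)"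
    have u: "?u \<in> V" using inV k by (simp add: m)
    have "insert v ((!) us ` set (Ks ! k)) \<subseteq> N ?u"
      using N_sym[OF k(2)] k by (auto simp: Ks)
    then have "card (insert v ((!) us ` set (Ks ! k))) \<le> d"
      using card_mono[OF finite_N[OF u]] card_N[OF u] by simp
    moreover have "v \<notin> (!) us ` set (Ks ! k)"
      using dist k(1) by (auto simp: Ks v_def nth_eq_iff_index_eq m_def[symmetric] m)
    moreover have "card ((!) us ` set (Ks ! k)) = card (set (Ks ! k))"
      using k(1) by (intro card_image inj) (auto simp: Ks m)
    then have "card ((!) us ` set (Ks ! k)) = length (Ks ! k)"
      using distinct_card[OF Ks(1)[OF k(1)]] by simp
    ultimately show ?thesis by simp
  qed
  define t where "t = length ws"
  define us' ls' Ks' where "us' = us @ ws" and "ls' = ls @ [K @ S @ [m..<m + t]]"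
    and "Ks' = map (\<lambda>k. if us ! (Suc i + k) \<in> N v then i # Ks ! k else Ks ! k) [0..<length Ks] @ replicate t [i]"
  have "(S @ [m..<m + t], Ks') \<in> set (attach d i (Suc i) (d - length K) Ks)"
    using attach_complete[of "\<lambda>k. us ! k \<in> N v" "Suc i" Ks "d - length K" d i] small count
    unfolding S_def[symmetric] unfolding m[symmetric] Ks'_def t_def by simp
  \<comment> \<open>This is what lets the new state pass the filter in
    \<open>extend\<close>.\<close>
  moreover have "distinct us'" "set us' \<subseteq> V"
    using dist sub ws N_subset[OF v] by (auto simp: us'_def)
  then have "length us' \<le> card V"
    using card_mono[OF finite_V, of "set us'"] distinct_card[of us'] by simp
  then have "length ls + length Ks' < card V"
    by (simp add: Ks'_def us'_def t_def flip: i_def) (simp add: m flip: m_def)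
  moreover have "(ls', Ks') = (\<lambda>(S, Ks'). (ls @ [K @ S], Ks')) (S @ [m..<m + t], Ks')"
    by (simp add: ls'_def)
  ultimately have "(ls', Ks') \<in> set (extend d (card V) (ls, K # Ks))"
    unfolding extend.simps set_filter set_map i_def[symmetric] by blast
  moreover have "explored us' ls' Ks'"
    unfolding explored_def
  proof (intro conjI allI impI)
    show "us' \<noteq> []" "distinct us'" "set us' \<subseteq> V" "length us' = length ls' + length Ks'"
      using ex dist ws sub N_subset[OF v]
      by (auto simp: us'_def ls'_def Ks'_def explored_def t_def)
    have old: "us' ! k = us ! k" if "k < m" for k using that by (simp add: us'_def m_def nth_append)
    fix k assume "k < length ls'"
    then consider "k < i" | "k = i" by (auto simp: ls'_def i_def less_Suc_eq)
    then have "N (us' ! k) = (!) us' ` set (ls' ! k) \<and> set (ls' ! k) \<subseteq> {..<length us'}"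
    proof cases
      case 1
      have "(!) us' ` set (ls ! k) = (!) us ` set (ls ! k)"
        using rows(2)[OF 1] old by (intro image_cong) auto
      with 1 rows[OF 1] old[of k] m have "N (us' ! k) = (!) us' ` set (ls' ! k)" 
        by (simp add: ls'_def nth_append i_def[symmetric])
      moreover have "set (ls' ! k) \<subseteq> {..<length us'}"
        using 1 rows(2)[OF 1] by (auto simp: ls'_def nth_append i_def[symmetric] us'_def m_def)
      ultimately show ?thesis ..
    next
      case 2
      have "(!) us' ` (set K \<union> set S) = (!) us ` (set K \<union> set S)"
        using old by (intro image_cong) (auto simp: K(2) setS m)
      also have "\<dots> = N v \<inter> set us" by (rule met[symmetric])
      finally have "(!) us' ` (set K \<union> set S) = N v \<inter> set us" .
      moreover have "(!) us' ` {m..<m + t} = N v - set us"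
      proof -
        have nth: "us' ! (m + x) = ws ! x" for x by (simp add: us'_def m_def)
        have "{m..<m + t} = (+) m ` {0..<t}" by (simp add: add.commute)
        then have "(!) us' ` {m..<m + t} = (!) ws ` {0..<t}"
          by (simp only: image_image nth)
        moreover have "(!) ws ` {0..<t} = set ws" by (auto simp: t_def set_conv_nth)
        ultimately show ?thesis by (simp only: ws(2))
      qed
      moreover have "set (K @ S @ [m..<m + t]) = set K \<union> set S \<union> {m..<m + t}" by auto
      ultimately have "N v = (!) us' ` set (K @ S @ [m..<m + t])"
        unfolding image_Un by blast
      then have "N (us' ! k) = (!) us' ` set (ls' ! k)"
        using 2 old[of i] m by (simp add: ls'_def i_def[symmetric] nth_append v_def)
      moreover have "set (ls' ! k) \<subseteq> {..<length us'}"
        using 2 by (auto simp: ls'_def i_def[symmetric] nth_append us'_def m_def[symmetric] K(2) setS m t_def)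
      ultimately show ?thesis ..
    qed
    then show "N (us' ! k) = (!) us' ` set (ls' ! k)" "set (ls' ! k) \<subseteq> {..<length us'}"
      by blast+
  next
    fix j assume j: "j < length Ks'"
    have old: "us' ! k = us ! k" if "k < m" for k using that by (simp add: us'_def m_def nth_append)
    have len: "length ls' = Suc i" by (simp add: ls'_def i_def)
    have *: "distinct (Ks' ! j) \<and> set (Ks' ! j) = {k. k < Suc i \<and> us' ! k \<in> N (us' ! (Suc i + j))}"
    proof (cases "j < length Ks")
      case True
      then have Kj: "Ks' ! j = (if us ! (Suc i + j) \<in> N v then i # Ks ! j else Ks ! j)"
        by (simp add: Ks'_def nth_append)
      have st: "{k. k < Suc i \<and> us' ! k \<in> N (us' ! (Suc i + j))}
          = {k. k < i \<and> us ! k \<in> N (us ! (Suc i + j))} \<union> (if us ! (Suc i + j) \<in> N v then {i} else {})"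
      proof -
        have "us' ! (Suc i + j) = us ! (Suc i + j)" using True m by (intro old) simp
        moreover have "us' ! k = us ! k" if "k < Suc i" for k using that m by (intro old) simp
        ultimately have "{k. k < Suc i \<and> us' ! k \<in> N (us' ! (Suc i + j))}
            = {k. k < Suc i \<and> us ! k \<in> N (us ! (Suc i + j))}" by auto
        then show ?thesis
          using N_commute[of v "us ! (Suc i + j)"] by (auto simp: less_Suc_eq v_def)
      qed
      show ?thesis
        unfolding Kj st using Ks[OF True] by (cases "us ! (Suc i + j) \<in> N v") auto
    next
      case False
      with j have jt: "j - length Ks < t" by (simp add: Ks'_def)
      with False have w: "us' ! (Suc i + j) = ws ! (j - length Ks)"
        using m by (simp add: us'_def nth_append m_def[symmetric])
      have new: "ws ! (j - length Ks) \<in> N v - set us" using jt ws(2) nth_mem[of "j - length Ks" ws] by (simp add: t_def)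
      \<comment> \<open>All neighbours of a processed vertex are already in \<open>us\<close>, so a
        vertex discovered now has no processed neighbour other than \<open>v\<close>.\<close>
      have none: "us ! k \<notin> N (ws ! (j - length Ks))" if "k < i" for k
      proof
        assume "us ! k \<in> N (ws ! (j - length Ks))"
        then have "ws ! (j - length Ks) \<in> N (us ! k)" by (rule N_sym)
        with rows[OF that] have "ws ! (j - length Ks) \<in> set us" by (auto simp: m_def)
        with new show False by blast
      qed
      have "{k. k < Suc i \<and> us' ! k \<in> N (us' ! (Suc i + j))} = {i}"
      proof -
        have "us' ! k = us ! k" if "k < Suc i" for k using that m by (intro old) simp
        then have "{k. k < Suc i \<and> us' ! k \<in> N (us' ! (Suc i + j))}
            = {k. k < Suc i \<and> us ! k \<in> N (ws ! (j - length Ks))}"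
          unfolding w by auto
        then show ?thesis
          using new N_commute[of v "ws ! (j - length Ks)"] none
          by (auto simp: less_Suc_eq v_def)
      qed
      moreover have "Ks' ! j = [i]" using False jt by (simp add: Ks'_def nth_append)
      ultimately show ?thesis by simp
    qed
    then show "distinct (Ks' ! j)" by (rule conjunct1)
    from * show "set (Ks' ! j) = {k. k < length ls' \<and> us' ! k \<in> N (us' ! (length ls' + j))}"
      unfolding len by (rule conjunct2)
  qed
  moreover have "length ls' = Suc (length ls)" by (simp add: ls'_def)
  ultimately show ?thesis by blast
qed

text \<open>With an empty queue the discovered vertices contain all their neighbours, so by
  connectedness they are all of \<open>V\<close>, yet there are only \<open>length ls\<close> of
  them.\<close>

lemma explored_unfinished:
  assumes "explored us ls Ks" "length ls < card V"
  shows "Ks \<noteq> []"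
proof
  assume "Ks = []"
  with assms(1) have us: "us \<noteq> []" "distinct us" "set us \<subseteq> V" "length us = length ls"
    by (simp_all add: explored_def)
  have rows: "N (us ! k) = (!) us ` set (ls ! k) \<and> set (ls ! k) \<subseteq> {..<length us}" if "k < length us" for k
    using assms(1) that unfolding us(4) explored_def by blast
  have "N v \<subseteq> set us" if "v \<in> set us" for v
  proof -
    obtain k where k: "k < length us" "v = us ! k"
      using \<open>v \<in> set us\<close> by (auto simp: in_set_conv_nth)
    have "(!) us ` set (ls ! k) \<subseteq> (!) us ` {..<length us}"
      using rows[OF k(1)] by (intro image_mono) blast
    also have "\<dots> = set us" by (auto simp: set_conv_nth)
    finally show ?thesis using rows[OF k(1)] k(2) by simp
  qed
  with us have "set us = V" by (intro connected) simp_all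
  with us assms(2) show False by (auto simp: distinct_card)
qed

lemma explored_level:
  assumes "t \<le> card V"
  shows "\<exists>us ls Ks. explored us ls Ks \<and> length ls = t \<and> (ls, Ks) \<in> set (levels d (card V) t)"
  using assms
proof (induction t)
  case 0
  obtain v where "v \<in> V" using V_nonempty by blast
  then have "explored [v] [] [[]]" by (simp add: explored_def)
  then show ?case by auto
next
  case (Suc t)
  then obtain us ls Ks where ex: "explored us ls Ks" and t: "length ls = t"
    and mem: "(ls, Ks) \<in> set (levels d (card V) t)" by auto
  with Suc.prems explored_unfinished[OF ex] obtain K Ks' where Ks: "Ks = K # Ks'" by (cases Ks) auto
  obtain us' ls' Ks'' where "explored us' ls' Ks''" "length ls' = Suc t"
    and "(ls', Ks'') \<in> set (extend d (card V) (ls, Ks))"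
    using explored_step[OF ex[unfolded Ks]] unfolding t Ks by blast
  with mem show ?case by (auto simp del: extend.simps)
qed

text \<open>At level \<open>card V\<close> the processed vertices already exhaust \<open>V\<close>;
  the queue is therefore empty and \<open>us\<close> enumerates \<open>V\<close>.\<close>

lemma levels_complete:
  obtains us ls Ks where "(ls, Ks) \<in> set (levels d (card V) (card V))"
    and "distinct us" "set us = V"
    and "\<And>k l. k < card V \<Longrightarrow> l < card V \<Longrightarrow> us ! l \<in> N (us ! k) \<longleftrightarrow> l \<in> set (ls ! k)"
    and "length ls = card V" "\<And>k. k < card V \<Longrightarrow> set (ls ! k) \<subseteq> {..<card V}"
proof -
  obtain us ls Ks where ex: "explored us ls Ks" and len: "length ls = card V"
    and mem: "(ls, Ks) \<in> set (levels d (card V) (card V))"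
    using explored_level[of "card V"] by auto
  have us: "distinct us" "set us \<subseteq> V" "length us = card V + length Ks"
    using ex len by (auto simp: explored_def)
  moreover have "length us \<le> card V"
    using us card_mono[OF finite_V us(2)] by (simp add: distinct_card)
  ultimately have "length us = card V" "set us = V"
    using card_subset_eq[OF finite_V, of "set us"] by (auto simp: distinct_card)
  moreover have rows: "N (us ! k) = (!) us ` set (ls ! k) \<and> set (ls ! k) \<subseteq> {..<card V}" if "k < card V" for k
    using ex len that \<open>length us = card V\<close> by (auto simp: explored_def)
  moreover have "us ! l \<in> N (us ! k) \<longleftrightarrow> l \<in> set (ls ! k)" if "k < card V" "l < card V" for k l
    using rows[OF that(1)] that(2) us(1) \<open>length us = card V\<close>
    by (auto simp: image_iff nth_eq_iff_index_eq subset_iff)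
  ultimately show ?thesis using that[OF mem us(1)] len by blast
qed

end

section \<open>Cubic graphs of order 10\<close>

text \<open>Rows are compared as sets, as the order within a neighbour list depends on the course of
  the exploration.\<close>

definition relabels :: "nat list list \<Rightarrow> nat list \<Rightarrow> nat list list \<Rightarrow> bool" where
  "relabels C \<rho> ls \<longleftrightarrow> length \<rho> = length C \<and> distinct \<rho> \<and> list_all (\<lambda>r. r < length C) \<rho> \<and>
     list_all2 (\<lambda>r c. set (map ((!) \<rho>) c) = set (ls ! r)) \<rho> C"

text \<open>
  A certificate \<open>(C, p, fs)\<close> consists of neighbour lists, the permanent, and the factors of the
  characteristic polynomial, each with the approximate multiples by \<open>N\<close> of its roots.
\<close>

definition valid_certificate :: "int \<Rightarrow> nat list list \<times> int \<times> (int list \<times> int list) list \<Rightarrow> bool" where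
  "valid_certificate N = (\<lambda>(C, p, fs).
     list_all (\<lambda>(i, l). distinct (i # l) \<and> list_all (\<lambda>j. j < length C) l) (zip [0..<length C] C) \<and>
     expand_rows (+) id (permanent_rows C) [([0..<length C], 1)] = [([], p)] \<and>
     expand_rows list_add (map uminus) (char_poly_rows C) [([0..<length C], [1])]
       = [([], foldr list_mult (map fst fs) [1])] \<and>
     list_all (\<lambda>(cs, ms). isolates N cs ms) fs \<and> length (concat (map snd fs)) = length C)"

text \<open>
  The connected cubic graphs of order 10. The \<open>k\<close>-th factor of each characteristic polynomial has as
  its simple roots the eigenvalues of multiplicity at least \<open>k\<close>.
\<close>

definition cubic_graphs :: "(nat list list \<times> int \<times> (int list \<times> int list) list) list" where
  "cubic_graphs =
   [([[1,2,3], [0,2,3], [0,1,4], [0,1,4], [2,3,5], [4,6,7], [5,8,9], [5,8,9], [6,7,9], [6,7,8]], 80,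
     [([0,-12,-44,7,57,6,-14,-1,1], [-5098,-4096,-2048,-592,0,2048,5690,6144]),
      ([0,1,1], [-2048,0])]),
    ([[1,2,3], [0,2,3], [0,1,4], [0,1,5], [2,5,6], [3,4,7], [4,8,9], [5,8,9], [6,7,9], [6,7,8]], 72,
     [([0,-24,-10,33,12,-10,-2,1], [-4096,-3198,-2048,0,2048,5246,6144]),
      ([-2,-1,2,1], [-4096,-2048,2048])]),
    ([[1,2,3], [0,2,4], [0,1,5], [0,4,5], [1,3,6], [2,3,7], [4,8,9], [5,8,9], [6,7,9], [6,7,8]], 73,
     [([3,26,30,-76,-96,48,69,-6,-15,0,1],
       [-5079,-3690,-3144,-2048,-911,-304,1486,2554,4993,6144])]),
    ([[1,2,3], [0,3,4], [0,4,5], [0,1,6], [1,2,5], [2,4,7], [3,8,9], [5,8,9], [6,7,9], [6,7,8]], 68,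
     [([0,-18,-57,-18,43,14,-11,-2,1], [-4096,-3547,-2048,-848,0,3547,4944,6144]),
      ([0,2,1], [-4096,0])]),
    ([[1,2,3], [0,4,5], [0,4,5], [0,4,6], [1,2,3], [1,2,7], [3,8,9], [5,8,9], [6,7,9], [6,7,8]], 100,
     [([0,-12,-56,-61,36,63,-4,-15,0,1], [-5762,-4096,-2048,-1084,-848,0,2750,4944,6144]),
      ([0,1], [0])]),
    ([[1,2,3], [0,2,4], [0,1,5], [0,4,6], [1,3,7], [2,6,8], [3,5,9], [4,8,9], [5,7,9], [6,7,8]], 68,
     [([0,24,64,-48,-121,28,71,-4,-15,0,1],
       [-5030,-4096,-3288,-2048,-754,0,2048,2628,4396,6144])]),
    ([[1,2,3], [0,3,4], [0,4,5], [0,1,6], [1,2,7], [2,7,8], [3,8,9], [4,5,9], [5,6,9], [6,7,8]], 85,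
     [([3,20,23,-64,-105,32,69,-4,-15,0,1],
       [-5362,-3811,-3314,-1266,-782,-520,1266,3314,4331,6144])]),
    ([[1,2,3], [0,4,5], [0,4,5], [0,6,7], [1,2,6], [1,2,8], [3,4,9], [3,8,9], [5,7,9], [6,7,8]], 80,
     [([0,12,35,-22,-96,12,67,-2,-15,0,1],
       [-5462,-4602,-2650,-1137,-872,0,1642,2682,4255,6144])]),
    ([[1,2,3], [0,3,4], [0,5,6], [0,1,7], [1,5,6], [2,4,8], [2,4,9], [3,8,9], [5,7,9], [6,7,8]], 65,
     [([21,5,-73,-16,52,8,-13,-1,1], [-5064,-3314,-2995,-1266,1266,3314,3964,6144]),
      ([-1,1,1], [-3314,1266])]),
    ([[1,2,3], [0,3,4], [0,5,6], [0,1,7], [1,5,8], [2,4,7], [2,8,9], [3,5,9], [4,6,9], [6,7,8]], 60,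
     [([-12,4,15,-5,-3,1], [-4096,-2048,2048,4096,6144]),
      ([-2,-1,2,1], [-4096,-2048,2048]),
      ([-2,1,1], [-4096,2048])]),
    ([[1,2,3], [0,4,5], [0,4,6], [0,5,6], [1,2,7], [1,3,8], [2,3,9], [4,8,9], [5,7,9], [6,7,8]], 81,
     [([-3,-20,-17,35,9,-12,-1,1], [-5549,-3690,-911,-397,2554,3898,6144]),
      ([-1,-2,1,1], [-3690,-911,2554])]),
    ([[1,2,3], [0,4,5], [0,3,6], [0,2,7], [1,5,6], [1,4,8], [2,4,9], [3,8,9], [5,7,9], [6,7,8]], 60,
     [([-6,-13,17,11,-8,-2,1], [-4096,-3138,-711,2048,3849,6144]),
      ([-2,-7,-3,2,1], [-4096,-3138,-711,3849])]),
    ([[1,2,3], [0,4,5], [0,4,6], [0,5,7], [1,2,7], [1,3,8], [2,8,9], [3,4,9], [5,6,9], [6,7,8]], 76,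
     [([-12,-8,91,-2,-132,8,71,-2,-15,0,1],
       [-5317,-4096,-3138,-2422,-711,1056,2048,2587,3849,6144])]),
    ([[1,2,3], [0,4,5], [0,4,5], [0,6,7], [1,2,8], [1,2,9], [3,8,9], [3,8,9], [4,6,7], [5,6,7]], 144,
     [([0,-36,0,49,0,-14,0,1], [-6144,-4096,-2048,0,2048,4096,6144]),
      ([0,-1,0,1], [-2048,0,2048])]),
    ([[1,2,3], [0,4,5], [0,4,6], [0,6,7], [1,2,8], [1,7,8], [2,3,9], [3,5,9], [4,5,9], [6,7,8]], 125,
     [([-3,-8,6,14,-8,-2,1], [-5362,-1266,-782,2048,3314,6144]),
      ([-1,-4,-3,2,1], [-5362,-1266,-782,3314])]),
    ([[1,2,3], [0,4,5], [0,4,6], [0,7,8], [1,2,7], [1,6,8], [2,5,9], [3,4,9], [3,5,9], [6,7,8]], 85,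
     [([-9,-12,59,36,-117,-12,69,0,-15,0,1],
       [-5362,-4716,-3314,-1266,-782,1266,2048,2668,3314,6144])]),
    ([[1,2,3], [0,4,5], [0,4,6], [0,5,7], [1,2,8], [1,3,9], [2,8,9], [3,8,9], [4,6,7], [5,6,7]], 169,
     [([-9,0,28,0,-12,0,1], [-6144,-3314,-1266,1266,3314,6144]),
      ([1,0,-3,0,1], [-3314,-1266,1266,3314])]),
    ([[1,2,3], [0,4,5], [0,4,6], [0,7,8], [1,2,7], [1,8,9], [2,8,9], [3,4,9], [3,5,6], [5,6,7]], 72,
     [([0,-24,2,35,-2,-12,0,1], [-5246,-4096,-2048,0,2048,3198,6144]),
      ([-2,1,1], [-4096,2048]),
      ([-1,1], [2048])]),
    ([[1,2,3], [0,4,5], [0,6,7], [0,8,9], [1,6,8], [1,7,9], [2,4,9], [2,5,8], [3,4,7], [3,5,6]], 60,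
     [([6,-5,-2,1], [-4096,2048,6144]),
      ([-2,1,1], [-4096,2048]),
      ([-2,1,1], [-4096,2048]),
      ([-2,1,1], [-4096,2048]),
      ([-1,1], [2048])])]"

text \<open>
  The entry \<open>(c, \<rho>)\<close> at position \<open>i\<close> says that \<open>\<rho>\<close> is an isomorphism from \<open>cubic_graphs ! c\<close> to the
  \<open>i\<close>-th outcome of the exploration.
\<close>

definition relabellings :: "(nat \<times> nat list) list" where
  "relabellings =
   [(0,[0,1,2,3,4,5,6,7,8,9]), (1,[0,1,2,3,4,5,6,7,8,9]), (2,[9,7,8,6,4,5,2,3,0,1]),
   (2,[9,6,8,7,4,5,2,3,0,1]), (3,[6,7,8,4,9,5,2,3,0,1]), (3,[6,7,9,4,8,5,2,3,0,1]),
   (4,[6,8,9,4,7,5,2,3,0,1]), (0,[0,2,1,3,4,5,6,7,8,9]), (1,[0,2,1,3,4,5,6,7,8,9]),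
   (2,[9,7,8,6,4,5,1,3,0,2]), (2,[9,6,8,7,4,5,1,3,0,2]), (3,[6,7,8,4,9,5,1,3,0,2]),
   (3,[6,7,9,4,8,5,1,3,0,2]), (4,[6,8,9,4,7,5,1,3,0,2]), (0,[1,2,0,4,3,5,6,7,8,9]),
   (1,[1,2,0,4,3,5,6,7,8,9]), (1,[1,2,0,4,3,6,5,9,7,8]), (3,[5,6,8,3,9,7,0,4,1,2]),
   (2,[8,6,9,5,3,7,0,4,1,2]), (2,[8,5,9,6,3,7,0,4,1,2]), (2,[9,5,8,6,3,7,0,4,1,2]),
   (4,[5,8,9,3,6,7,0,4,1,2]), (2,[0,1,2,3,4,5,6,7,8,9]), (2,[1,0,2,4,3,5,6,7,8,9]),
   (3,[0,1,3,2,4,6,5,9,7,8]), (5,[0,1,2,3,4,5,6,7,8,9]), (5,[1,0,2,4,3,5,7,6,8,9]),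
   (6,[0,1,3,2,4,6,5,7,8,9]), (6,[0,1,3,2,4,6,5,7,9,8]), (7,[6,8,9,3,7,5,4,0,2,1]),
   (2,[2,0,1,5,3,4,6,7,8,9]), (5,[0,2,1,3,5,4,6,8,7,9]), (3,[0,2,3,1,5,6,4,9,7,8]),
   (5,[2,0,1,5,3,4,7,6,8,9]), (5,[2,0,1,5,3,4,8,6,7,9]), (7,[6,7,8,3,9,4,5,0,1,2]),
   (6,[0,2,3,1,5,6,4,9,7,8]), (6,[0,2,3,1,5,6,4,9,8,7]), (5,[1,2,0,4,5,3,6,8,7,9]),
   (5,[1,2,0,4,5,3,7,8,6,9]), (5,[2,1,0,5,4,3,6,8,7,9]), (5,[2,1,0,5,4,3,7,8,6,9]),
   (3,[1,2,4,0,5,8,3,9,6,7]), (6,[1,2,4,0,5,8,3,9,6,7]), (6,[1,2,4,0,5,8,3,9,7,6]),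
   (7,[8,6,7,4,9,3,5,1,0,2]), (8,[0,1,3,2,4,6,7,5,8,9]), (8,[0,1,3,2,4,6,7,5,9,8]),
   (9,[0,1,3,2,4,6,7,5,8,9]), (10,[9,6,7,8,3,4,5,0,1,2]), (11,[1,4,0,2,6,8,3,5,9,7]),
   (12,[8,9,4,7,6,5,1,3,2,0]), (11,[0,3,1,2,6,7,4,5,9,8]), (12,[7,9,3,8,6,5,0,4,2,1]),
   (10,[9,6,7,8,3,5,4,0,2,1]), (12,[8,9,4,6,7,5,1,3,2,0]), (11,[1,4,0,2,7,8,3,5,9,6]),
   (9,[0,1,3,2,4,7,6,5,8,9]), (11,[0,3,1,2,7,6,4,5,9,8]), (12,[6,9,3,8,7,5,0,4,2,1]),
   (8,[0,2,3,1,5,6,7,4,8,9]), (8,[0,2,3,1,5,6,7,4,9,8]), (11,[0,3,2,1,6,7,5,4,9,8]),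
   (12,[7,9,3,8,6,4,0,5,1,2]), (11,[0,3,2,1,6,7,5,4,8,9]), (12,[7,8,3,9,6,4,0,5,1,2]),
   (11,[0,3,2,1,7,6,5,4,9,8]), (12,[6,9,3,8,7,4,0,5,1,2]), (11,[0,3,2,1,7,6,5,4,8,9]),
   (12,[6,8,3,9,7,4,0,5,1,2]), (8,[1,2,4,0,5,8,9,3,6,7]), (8,[1,2,4,0,5,8,9,3,7,6]),
   (0,[0,3,1,2,4,5,6,7,8,9]), (1,[0,3,1,2,4,5,6,7,8,9]), (2,[9,7,8,6,4,5,1,2,0,3]),
   (2,[9,6,8,7,4,5,1,2,0,3]), (3,[6,7,8,4,9,5,1,2,0,3]), (3,[6,7,9,4,8,5,1,2,0,3]),
   (4,[6,8,9,4,7,5,1,2,0,3]), (0,[1,3,0,4,2,5,6,7,8,9]), (2,[0,1,3,2,4,5,6,7,8,9]),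
   (3,[0,1,2,3,4,5,6,7,8,9]), (2,[1,0,3,4,2,6,5,9,7,8]), (5,[0,1,3,2,4,6,5,7,9,8]),
   (6,[0,1,2,3,4,5,6,7,8,9]), (5,[1,0,3,4,2,6,7,5,8,9]), (5,[1,0,3,4,2,6,7,5,9,8]),
   (7,[5,8,9,2,7,6,4,0,3,1]), (1,[1,3,0,4,2,5,6,7,8,9]), (1,[1,3,0,4,2,6,5,9,7,8]),
   (3,[5,6,8,2,9,7,0,4,1,3]), (2,[8,6,9,5,2,7,0,4,1,3]), (2,[8,5,9,6,2,7,0,4,1,3]),
   (2,[9,5,8,6,2,7,0,4,1,3]), (4,[5,8,9,2,6,7,0,4,1,3]), (2,[3,0,1,5,2,4,6,7,8,9]),
   (5,[0,3,1,2,5,4,6,8,7,9]), (3,[0,3,2,1,5,6,4,9,7,8]), (5,[3,0,1,5,2,4,7,6,8,9]),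
   (5,[3,0,1,5,2,4,8,6,7,9]), (7,[6,7,8,2,9,4,5,0,1,3]), (6,[0,3,2,1,5,6,4,9,7,8]),
   (6,[0,3,2,1,5,6,4,9,8,7]), (5,[0,3,1,2,6,4,5,9,7,8]), (2,[3,0,1,6,2,4,5,7,8,9]),
   (3,[0,3,2,1,6,5,4,9,7,8]), (7,[5,7,8,2,9,4,6,0,1,3]), (5,[3,0,1,6,2,4,8,5,7,9]),
   (6,[0,3,2,1,6,5,4,9,7,8]), (5,[3,0,1,6,2,4,7,5,8,9]), (6,[0,3,2,1,6,5,4,9,8,7]),
   (8,[0,1,2,3,4,5,6,7,8,9]), (5,[1,3,0,4,7,2,5,9,6,8]), (11,[0,2,1,3,5,6,4,7,9,8]),
   (9,[0,1,2,3,4,5,6,7,8,9]), (11,[1,4,0,3,5,8,2,7,9,6]), (12,[8,9,4,6,5,7,1,2,3,0]),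
   (10,[9,5,6,8,2,4,7,0,1,3]), (12,[6,9,2,8,5,7,0,4,3,1]), (5,[1,3,0,4,7,2,6,9,5,8]),
   (5,[1,3,0,4,7,2,6,8,5,9]), (11,[0,2,1,3,6,5,4,7,9,8]), (12,[8,9,4,5,6,7,1,2,3,0]),
   (11,[1,4,0,3,6,8,2,7,9,5]), (10,[9,5,6,8,2,7,4,0,3,1]), (9,[0,1,2,3,4,6,5,7,8,9]),
   (12,[5,9,2,8,6,7,0,4,3,1]), (6,[1,3,4,0,7,8,2,9,5,6]), (6,[1,3,4,0,7,8,2,9,6,5]),
   (3,[1,3,4,0,7,8,2,9,5,6]), (5,[3,1,0,7,4,2,5,8,6,9]), (5,[3,1,0,7,4,2,6,8,5,9]),
   (7,[8,5,6,4,9,2,7,1,0,3]), (11,[0,2,3,1,5,6,7,4,8,9]), (11,[0,2,3,1,5,6,7,4,9,8]),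
   (11,[0,2,3,1,6,5,7,4,8,9]), (8,[1,3,4,0,7,8,9,2,5,6]), (11,[0,2,3,1,6,5,7,4,9,8]),
   (8,[1,3,4,0,7,8,9,2,6,5]), (8,[0,3,2,1,7,5,6,4,8,9]), (12,[6,8,2,9,5,4,0,7,1,3]),
   (8,[0,3,2,1,7,5,6,4,9,8]), (12,[6,9,2,8,5,4,0,7,1,3]), (12,[5,8,2,9,6,4,0,7,1,3]),
   (12,[5,9,2,8,6,4,0,7,1,3]), (0,[2,3,0,4,1,5,6,7,8,9]), (2,[0,2,3,1,4,5,6,7,8,9]),
   (3,[0,2,1,3,4,5,6,7,8,9]), (2,[2,0,3,4,1,6,5,9,7,8]), (5,[0,2,3,1,4,6,5,7,9,8]),
   (6,[0,2,1,3,4,5,6,7,8,9]), (5,[2,0,3,4,1,6,7,5,8,9]), (5,[2,0,3,4,1,6,7,5,9,8]),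
   (7,[5,8,9,1,7,6,4,0,3,2]), (2,[0,2,3,1,5,4,7,6,8,9]), (0,[2,3,0,5,1,4,6,7,8,9]),
   (3,[0,2,1,3,5,4,6,7,8,9]), (5,[0,2,3,1,5,6,4,8,9,7]), (2,[2,0,3,5,1,6,4,9,7,8]),
   (6,[0,2,1,3,5,4,6,7,8,9]), (6,[0,2,1,3,5,4,6,8,7,9]), (7,[4,7,8,1,9,6,5,0,3,2]),
   (5,[2,0,3,5,1,6,9,4,7,8]), (5,[2,0,3,5,1,6,9,4,8,7]), (3,[0,3,1,2,4,5,6,7,8,9]),
   (2,[3,0,2,4,1,6,5,9,7,8]), (5,[0,3,2,1,4,6,5,7,9,8]), (6,[0,3,1,2,4,5,6,7,8,9]),
   (5,[3,0,2,4,1,6,7,5,8,9]), (5,[3,0,2,4,1,6,7,5,9,8]), (7,[5,8,9,1,7,6,4,0,2,3]),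
   (3,[0,3,1,2,5,4,6,7,8,9]), (5,[0,3,2,1,5,6,4,8,9,7]), (2,[3,0,2,5,1,6,4,9,7,8]),
   (6,[0,3,1,2,5,4,6,7,8,9]), (6,[0,3,1,2,5,4,6,8,7,9]), (7,[4,7,8,1,9,6,5,0,2,3]),
   (5,[3,0,2,5,1,6,9,4,7,8]), (5,[3,0,2,5,1,6,9,4,8,7]), (3,[4,5,7,1,8,9,0,6,2,3]),
   (1,[2,3,0,6,1,4,5,7,8,9]), (1,[2,3,0,6,1,5,4,9,7,8]), (4,[4,7,8,1,5,9,0,6,2,3]),
   (2,[7,5,9,4,1,8,0,6,2,3]), (2,[7,4,8,5,1,9,0,6,2,3]), (2,[8,5,9,4,1,7,0,6,2,3]),
   (2,[8,4,7,5,1,9,0,6,2,3]), (11,[0,1,2,3,4,5,6,7,8,9]), (11,[0,1,3,2,4,5,7,6,8,9]),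
   (11,[0,1,2,3,5,4,6,7,8,9]), (11,[0,1,3,2,5,4,7,6,8,9]), (3,[2,3,6,0,7,9,1,8,4,5]),
   (6,[2,3,6,0,7,8,1,9,4,5]), (6,[2,3,6,0,7,9,1,8,5,4]), (8,[2,3,6,0,7,8,9,1,4,5]),
   (9,[0,2,1,3,6,4,5,7,8,9]), (9,[0,2,1,3,6,4,5,7,9,8]), (8,[0,2,1,3,6,4,5,7,8,9]),
   (10,[8,4,5,9,1,6,7,0,2,3]), (11,[2,6,0,3,4,8,1,7,9,5]), (12,[8,9,7,4,5,6,3,1,2,0]),
   (5,[2,3,0,6,7,1,4,9,5,8]), (12,[5,8,1,9,4,7,0,6,3,2]), (10,[8,4,5,9,1,7,6,0,3,2]),
   (12,[8,9,6,4,5,7,2,1,3,0]), (11,[2,6,0,3,5,9,1,7,8,4]), (8,[0,3,1,2,7,4,5,6,8,9]),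
   (5,[3,2,0,7,6,1,4,9,5,8]), (12,[5,8,1,9,4,6,0,7,2,3]), (9,[0,2,1,3,6,5,4,7,8,9]),
   (9,[0,2,1,3,6,5,4,7,9,8]), (5,[2,3,0,6,7,1,5,9,4,8]), (12,[4,8,1,9,5,7,0,6,3,2]),
   (5,[2,3,0,6,7,1,5,8,4,9]), (12,[4,9,1,8,5,7,0,6,3,2]), (5,[3,2,0,7,6,1,5,9,4,8]),
   (12,[4,8,1,9,5,6,0,7,2,3]), (5,[3,2,0,7,6,1,5,8,4,9]), (12,[4,9,1,8,5,6,0,7,2,3]),
   (7,[8,4,5,6,9,1,7,2,0,3]), (7,[8,4,5,7,9,1,6,3,0,2]), (4,[0,1,2,3,4,5,6,7,8,9]),
   (4,[0,1,2,3,5,4,6,7,8,9]), (0,[4,5,1,2,0,3,6,7,8,9]), (7,[0,1,2,3,4,5,6,7,8,9]),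
   (7,[0,1,2,3,4,5,7,6,8,9]), (7,[0,1,2,3,5,4,6,7,8,9]), (7,[0,1,2,3,5,4,7,6,8,9]),
   (4,[1,4,5,0,2,8,3,9,6,7]), (7,[4,1,2,8,5,0,9,6,3,7]), (7,[4,1,2,8,5,0,9,7,3,6]),
   (13,[0,1,2,3,4,5,6,7,8,9]), (4,[0,1,3,2,4,5,6,7,8,9]), (4,[0,2,3,1,4,6,5,9,7,8]),
   (7,[1,0,4,5,2,3,6,8,7,9]), (7,[1,0,4,5,3,2,7,8,6,9]), (7,[2,0,4,6,3,1,7,8,5,9]),
   (7,[2,0,4,6,3,1,7,9,5,8]), (13,[1,0,4,5,2,3,8,9,6,7]), (10,[0,1,2,3,4,5,6,7,8,9]),
   (2,[1,4,5,0,2,3,6,7,8,9]), (6,[2,4,0,6,1,3,9,5,7,8]), (12,[0,1,2,3,4,5,6,7,8,9]),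
   (12,[0,1,3,2,5,4,7,6,8,9]), (6,[3,5,0,7,1,2,9,4,6,8]), (10,[1,0,4,5,2,3,8,6,7,9]),
   (14,[0,2,1,3,4,6,5,7,8,9]), (15,[6,7,9,2,8,3,5,4,0,1]), (16,[0,1,2,3,4,5,6,7,8,9]),
   (6,[1,4,0,5,2,3,8,6,7,9]), (2,[2,4,6,0,1,3,5,7,8,9]), (12,[0,2,1,3,4,6,5,7,8,9]),
   (12,[0,2,1,3,4,6,5,7,9,8]), (12,[0,2,3,1,6,4,7,5,8,9]), (14,[0,1,2,3,4,5,6,7,8,9]),
   (10,[2,0,4,6,1,3,8,5,7,9]), (15,[5,7,9,1,8,3,6,4,0,2]), (6,[3,6,0,7,2,1,9,4,5,8]),
   (16,[0,2,1,3,4,6,5,7,8,9]), (2,[4,1,5,2,0,6,3,9,7,8]), (5,[1,4,5,0,2,7,3,6,9,8]),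
   (5,[1,4,5,0,2,8,3,6,9,7]), (7,[3,7,8,0,6,9,2,1,5,4]), (5,[4,1,5,2,0,9,6,3,8,7]),
   (5,[4,1,5,2,0,9,6,3,7,8]), (2,[4,2,6,1,0,5,3,9,7,8]), (7,[3,7,8,0,5,9,1,2,6,4]),
   (5,[2,4,6,0,1,8,3,5,9,7]), (5,[4,2,6,1,0,9,5,3,8,7]), (5,[2,4,6,0,1,7,3,5,9,8]),
   (5,[4,2,6,1,0,9,5,3,7,8]), (15,[0,1,2,3,4,5,6,7,8,9]), (15,[0,2,1,3,4,6,5,7,8,9]),
   (8,[3,7,0,8,4,1,2,9,5,6]), (12,[1,4,5,0,7,2,9,3,6,8]), (12,[2,4,6,0,7,1,9,3,5,8]),
   (17,[0,1,2,3,4,5,6,7,8,9]), (15,[0,1,2,3,4,5,6,8,7,9]), (15,[0,2,1,3,4,6,5,8,7,9]),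
   (8,[3,8,0,7,4,1,2,9,5,6]), (17,[0,1,2,3,4,5,6,8,7,9]), (12,[2,4,6,0,8,1,9,3,5,7]),
   (12,[1,4,5,0,8,2,9,3,6,7]), (17,[1,0,4,5,2,3,9,6,7,8]), (12,[2,4,0,6,1,9,3,5,8,7]),
   (17,[1,0,4,5,2,3,9,6,8,7]), (12,[2,4,0,6,1,9,3,5,7,8]), (12,[1,4,0,5,2,9,3,6,8,7]),
   (12,[1,4,0,5,2,9,3,6,7,8]), (15,[3,7,8,0,5,6,9,1,2,4]), (15,[3,8,7,0,5,6,9,1,2,4]),
   (15,[3,7,8,0,6,5,9,2,1,4]), (10,[4,1,2,9,0,5,6,3,7,8]), (15,[3,8,7,0,6,5,9,2,1,4]),
   (10,[4,1,2,9,0,5,6,3,8,7]), (4,[0,1,3,2,5,4,6,7,8,9]), (10,[0,1,2,3,5,4,6,8,7,9]),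
   (2,[1,4,5,0,3,2,7,6,8,9]), (12,[0,1,3,2,4,5,7,6,8,9]), (6,[3,4,0,7,1,2,9,5,6,8]),
   (6,[2,5,0,6,1,3,9,4,7,8]), (12,[0,1,2,3,5,4,6,7,8,9]), (10,[1,0,4,5,3,2,8,7,6,9]),
   (15,[6,7,8,2,9,3,4,5,0,1]), (14,[0,2,1,3,5,6,4,7,9,8]), (16,[0,1,2,3,5,4,6,7,9,8]),
   (4,[0,2,3,1,5,6,4,9,7,8]), (7,[1,0,5,4,2,3,6,8,7,9]), (7,[1,0,5,4,3,2,7,8,6,9]),
   (7,[2,0,5,6,3,1,7,8,4,9]), (7,[2,0,5,6,3,1,7,9,4,8]), (13,[1,0,5,4,2,3,8,9,6,7]),
   (6,[1,5,0,4,2,3,8,6,7,9]), (12,[0,2,3,1,6,5,7,4,9,8]), (14,[0,1,2,3,5,4,6,7,8,9]),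
   (15,[4,7,8,1,9,3,6,5,0,2]), (10,[2,0,5,6,1,3,9,4,7,8]), (2,[2,5,6,0,1,3,4,7,8,9]),
   (12,[0,2,1,3,5,6,4,7,8,9]), (12,[0,2,1,3,5,6,4,7,9,8]), (6,[3,6,0,7,2,1,9,5,4,8]),
   (16,[0,2,1,3,5,6,4,7,8,9]), (6,[3,6,0,7,2,1,8,5,4,9]), (16,[0,2,1,3,5,6,4,7,9,8]),
   (2,[5,1,4,2,0,6,3,9,7,8]), (5,[1,5,4,0,2,7,3,6,9,8]), (5,[1,5,4,0,2,8,3,6,9,7]),
   (7,[3,7,8,0,6,9,2,1,4,5]), (5,[5,1,4,2,0,9,6,3,8,7]), (5,[5,1,4,2,0,9,6,3,7,8]),
   (15,[0,1,2,3,5,4,6,8,7,9]), (17,[1,0,5,4,2,3,9,6,7,8]), (12,[2,5,0,6,1,9,3,4,8,7]),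
   (15,[0,1,2,3,5,4,6,7,8,9]), (17,[1,0,5,4,2,3,9,6,8,7]), (12,[2,5,0,6,1,9,3,4,7,8]),
   (2,[5,2,6,1,0,4,3,9,7,8]), (15,[0,2,1,3,5,6,4,7,8,9]), (8,[3,7,0,8,5,1,2,9,4,6]),
   (15,[0,2,1,3,5,6,4,8,7,9]), (8,[3,8,0,7,5,1,2,9,4,6]), (12,[1,5,0,4,2,9,3,6,8,7]),
   (12,[1,5,0,4,2,9,3,6,7,8]), (7,[3,7,8,0,4,9,1,2,6,5]), (15,[3,7,8,0,4,6,9,1,2,5]),
   (15,[3,8,7,0,4,6,9,1,2,5]), (5,[2,5,6,0,1,8,3,4,9,7]), (5,[5,2,6,1,0,9,4,3,8,7]),
   (12,[1,5,4,0,7,2,9,3,6,8]), (17,[0,1,2,3,5,4,6,8,7,9]), (12,[2,5,6,0,8,1,9,3,4,7]),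
   (15,[3,7,8,0,6,4,9,2,1,5]), (10,[5,1,2,9,0,4,6,3,7,8]), (5,[2,5,6,0,1,7,3,4,9,8]),
   (5,[5,2,6,1,0,9,4,3,7,8]), (12,[2,5,6,0,7,1,9,3,4,8]), (17,[0,1,2,3,5,4,6,7,8,9]),
   (12,[1,5,4,0,8,2,9,3,6,7]), (15,[3,8,7,0,6,4,9,2,1,5]), (10,[5,1,2,9,0,4,6,3,8,7]),
   (0,[4,5,1,3,0,2,6,7,8,9]), (7,[0,1,3,2,4,5,6,7,8,9]), (7,[0,1,3,2,4,5,7,6,8,9]),
   (7,[0,1,3,2,5,4,6,7,8,9]), (7,[0,1,3,2,5,4,7,6,8,9]), (4,[1,4,5,0,3,8,2,9,6,7]),
   (7,[4,1,3,8,5,0,9,6,2,7]), (7,[4,1,3,8,5,0,9,7,2,6]), (13,[0,1,3,2,4,5,6,7,8,9]),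
   (6,[1,4,0,5,3,2,8,6,7,9]), (2,[3,4,6,0,1,2,5,7,8,9]), (12,[0,3,1,2,4,6,5,7,8,9]),
   (12,[0,3,1,2,4,6,5,7,9,8]), (12,[0,3,2,1,6,4,7,5,8,9]), (14,[0,1,3,2,4,5,6,7,8,9]),
   (10,[3,0,4,6,1,2,8,5,7,9]), (15,[5,7,9,1,8,2,6,4,0,3]), (6,[2,6,0,7,3,1,9,4,5,8]),
   (16,[0,3,1,2,4,6,5,7,8,9]), (6,[1,4,0,5,3,2,8,7,6,9]), (12,[0,3,1,2,4,7,5,6,9,8]),
   (12,[0,3,1,2,4,7,5,6,8,9]), (2,[3,4,7,0,1,2,5,6,8,9]), (14,[0,1,3,2,4,5,7,6,8,9]),
   (15,[5,6,9,1,8,2,7,4,0,3]), (10,[3,0,4,7,1,2,8,5,6,9]), (12,[0,3,2,1,7,4,6,5,8,9]),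
   (6,[2,7,0,6,3,1,9,4,5,8]), (16,[0,3,1,2,4,7,5,6,8,9]), (5,[1,4,5,0,3,6,2,8,9,7]),
   (5,[1,4,5,0,3,7,2,8,9,6]), (2,[4,1,5,3,0,8,2,9,6,7]), (5,[4,1,5,3,0,9,8,2,7,6]),
   (5,[4,1,5,3,0,9,8,2,6,7]), (7,[2,6,7,0,8,9,3,1,5,4]), (12,[1,4,5,0,6,3,9,2,8,7]),
   (15,[0,1,3,2,4,5,8,6,7,9]), (12,[3,4,8,0,6,1,9,2,5,7]), (17,[0,1,3,2,4,5,8,6,7,9]),
   (8,[2,6,0,7,4,1,3,9,5,8]), (15,[0,3,1,2,4,8,5,6,7,9]), (15,[0,1,3,2,4,5,8,7,6,9]),
   (17,[0,1,3,2,4,5,8,7,6,9]), (12,[3,4,8,0,7,1,9,2,5,6]), (12,[1,4,5,0,7,3,9,2,8,6]),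
   (8,[2,7,0,6,4,1,3,9,5,8]), (15,[0,3,1,2,4,8,5,7,6,9]), (7,[2,6,7,0,5,9,1,3,8,4]),
   (5,[4,3,8,1,0,9,5,2,7,6]), (5,[3,4,8,0,1,7,2,5,9,6]), (5,[4,3,8,1,0,9,5,2,6,7]),
   (5,[3,4,8,0,1,6,2,5,9,7]), (2,[4,3,8,1,0,5,2,9,6,7]), (15,[2,6,7,0,5,8,9,1,3,4]),
   (15,[2,7,6,0,5,8,9,1,3,4]), (12,[3,4,0,8,1,9,2,5,7,6]), (17,[1,0,4,5,3,2,9,8,6,7]),
   (10,[4,1,3,9,0,5,8,2,6,7]), (15,[2,6,7,0,8,5,9,3,1,4]), (12,[3,4,0,8,1,9,2,5,6,7]),
   (17,[1,0,4,5,3,2,9,8,7,6]), (10,[4,1,3,9,0,5,8,2,7,6]), (15,[2,7,6,0,8,5,9,3,1,4]),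
   (12,[1,4,0,5,3,9,2,8,7,6]), (12,[1,4,0,5,3,9,2,8,6,7]), (6,[1,5,0,4,3,2,8,6,7,9]),
   (12,[0,3,2,1,6,5,7,4,9,8]), (14,[0,1,3,2,5,4,6,7,8,9]), (15,[4,7,8,1,9,2,6,5,0,3]),
   (10,[3,0,5,6,1,2,9,4,7,8]), (2,[3,5,6,0,1,2,4,7,8,9]), (12,[0,3,1,2,5,6,4,7,8,9]),
   (12,[0,3,1,2,5,6,4,7,9,8]), (6,[2,6,0,7,3,1,9,5,4,8]), (16,[0,3,1,2,5,6,4,7,8,9]),
   (6,[2,6,0,7,3,1,8,5,4,9]), (16,[0,3,1,2,5,6,4,7,9,8]), (6,[1,5,0,4,3,2,8,7,6,9]),
   (14,[0,1,3,2,5,4,7,6,8,9]), (10,[3,0,5,7,1,2,9,4,6,8]), (15,[4,6,8,1,9,2,7,5,0,3]),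
   (12,[0,3,2,1,7,5,6,4,9,8]), (12,[0,3,1,2,5,7,4,6,9,8]), (12,[0,3,1,2,5,7,4,6,8,9]),
   (2,[3,5,7,0,1,2,4,6,8,9]), (6,[2,7,0,6,3,1,9,5,4,8]), (16,[0,3,1,2,5,7,4,6,8,9]),
   (6,[2,7,0,6,3,1,8,5,4,9]), (16,[0,3,1,2,5,7,4,6,9,8]), (5,[1,5,4,0,3,6,2,8,9,7]),
   (5,[1,5,4,0,3,7,2,8,9,6]), (2,[5,1,4,3,0,8,2,9,6,7]), (5,[5,1,4,3,0,9,8,2,7,6]),
   (5,[5,1,4,3,0,9,8,2,6,7]), (7,[2,6,7,0,8,9,3,1,4,5]), (7,[2,6,7,0,4,9,1,3,8,5]),
   (15,[2,6,7,0,4,8,9,1,3,5]), (15,[2,7,6,0,4,8,9,1,3,5]), (15,[0,1,3,2,5,4,8,7,6,9]),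
   (12,[3,5,0,8,1,9,2,4,7,6]), (17,[1,0,5,4,3,2,9,8,6,7]), (12,[1,5,4,0,6,3,9,2,8,7]),
   (17,[0,1,3,2,5,4,8,7,6,9]), (12,[3,5,8,0,7,1,9,2,4,6]), (5,[5,3,8,1,0,9,4,2,7,6]),
   (5,[3,5,8,0,1,7,2,4,9,6]), (10,[5,1,3,9,0,4,8,2,6,7]), (15,[2,6,7,0,8,4,9,3,1,5]),
   (15,[0,1,3,2,5,4,8,6,7,9]), (12,[3,5,0,8,1,9,2,4,6,7]), (17,[1,0,5,4,3,2,9,8,7,6]),
   (12,[3,5,8,0,6,1,9,2,4,7]), (17,[0,1,3,2,5,4,8,6,7,9]), (12,[1,5,4,0,7,3,9,2,8,6]),
   (5,[5,3,8,1,0,9,4,2,6,7]), (5,[3,5,8,0,1,6,2,4,9,7]), (10,[5,1,3,9,0,4,8,2,7,6]),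
   (15,[2,7,6,0,8,4,9,3,1,5]), (8,[2,6,0,7,5,1,3,9,4,8]), (15,[0,3,1,2,5,8,4,6,7,9]),
   (8,[2,7,0,6,5,1,3,9,4,8]), (15,[0,3,1,2,5,8,4,7,6,9]), (2,[5,3,8,1,0,4,2,9,6,7]),
   (12,[1,5,0,4,3,9,2,8,7,6]), (12,[1,5,0,4,3,9,2,8,6,7]), (4,[2,6,7,0,3,9,1,8,4,5]),
   (7,[6,2,3,8,7,0,9,4,1,5]), (7,[6,2,3,9,7,0,8,5,1,4]), (7,[0,2,3,1,6,7,4,5,9,8]),
   (7,[0,2,3,1,7,6,4,5,9,8]), (7,[0,2,3,1,6,7,5,4,9,8]), (7,[0,2,3,1,6,7,5,4,8,9]),
   (7,[0,2,3,1,7,6,5,4,9,8]), (7,[0,2,3,1,7,6,5,4,8,9]), (0,[6,7,2,3,0,1,4,5,8,9]),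
   (13,[0,2,3,1,6,7,4,5,8,9]), (13,[0,2,3,1,6,7,4,5,9,8]), (8,[1,4,0,5,6,2,3,9,7,8]),
   (10,[6,2,3,9,0,7,8,1,4,5]), (5,[4,5,1,7,9,0,2,8,3,6]), (12,[3,6,0,8,2,9,1,7,5,4]),
   (10,[6,2,3,9,0,7,8,1,5,4]), (5,[4,5,1,8,9,0,3,7,2,6]), (12,[2,6,0,7,3,9,1,8,5,4]),
   (8,[1,5,0,4,6,2,3,9,7,8]), (5,[5,4,1,7,9,0,2,8,3,6]), (12,[3,6,0,8,2,9,1,7,4,5]),
   (5,[5,4,1,8,9,0,3,7,2,6]), (12,[2,6,0,7,3,9,1,8,4,5]), (2,[6,2,7,3,0,8,1,9,4,5]),
   (2,[6,3,8,2,0,7,1,9,4,5]), (12,[2,6,7,0,4,3,9,1,8,5]), (12,[3,6,8,0,4,2,9,1,7,5]),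
   (17,[0,2,3,1,6,7,8,4,5,9]), (15,[0,2,3,1,6,7,8,4,5,9]), (15,[0,3,2,1,6,8,7,4,5,9]),
   (17,[0,2,3,1,6,7,8,5,4,9]), (15,[1,4,5,0,7,8,9,2,3,6]), (15,[1,4,5,0,8,7,9,3,2,6]),
   (12,[3,6,8,0,5,2,9,1,7,4]), (15,[0,2,3,1,6,7,8,5,4,9]), (15,[1,5,4,0,7,8,9,2,3,6]),
   (7,[1,4,5,0,7,9,2,3,8,6]), (5,[2,6,7,0,3,4,1,8,9,5]), (5,[3,6,8,0,2,5,1,7,9,4]),
   (17,[2,0,6,7,3,1,9,8,4,5]), (12,[2,6,7,0,5,3,9,1,8,4]), (15,[0,3,2,1,6,8,7,5,4,9]),
   (15,[1,5,4,0,8,7,9,3,2,6]), (5,[2,6,7,0,3,5,1,8,9,4]), (5,[3,6,8,0,2,4,1,7,9,5]),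
   (17,[2,0,6,7,3,1,9,8,5,4]), (7,[1,4,5,0,8,9,3,2,7,6]), (10,[7,2,3,9,0,6,8,1,4,5]),
   (12,[3,7,0,8,2,9,1,6,5,4]), (5,[4,5,1,6,9,0,2,8,3,7]), (8,[1,4,0,5,7,2,3,9,6,8]),
   (10,[7,2,3,9,0,6,8,1,5,4]), (5,[4,5,1,8,9,0,3,6,2,7]), (12,[2,7,0,6,3,9,1,8,5,4]),
   (12,[3,7,0,8,2,9,1,6,4,5]), (5,[5,4,1,6,9,0,2,8,3,7]), (8,[1,5,0,4,7,2,3,9,6,8]),
   (5,[5,4,1,8,9,0,3,6,2,7]), (12,[2,7,0,6,3,9,1,8,4,5]), (2,[7,2,6,3,0,8,1,9,4,5]),
   (2,[7,3,8,2,0,6,1,9,4,5]), (12,[2,7,6,0,4,3,9,1,8,5]), (15,[1,4,5,0,6,8,9,2,3,7]),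
   (17,[0,2,3,1,7,6,8,5,4,9]), (15,[1,4,5,0,8,6,9,3,2,7]), (15,[1,5,4,0,6,8,9,2,3,7]),
   (7,[1,4,5,0,6,9,2,3,8,7]), (12,[3,7,8,0,5,2,9,1,6,4]), (15,[0,2,3,1,7,6,8,5,4,9]),
   (5,[2,7,6,0,3,4,1,8,9,5]), (17,[2,0,7,6,3,1,9,8,4,5]), (5,[3,7,8,0,2,5,1,6,9,4]),
   (12,[3,7,8,0,4,2,9,1,6,5]), (17,[0,2,3,1,7,6,8,4,5,9]), (15,[0,2,3,1,7,6,8,4,5,9]),
   (15,[0,3,2,1,7,8,6,4,5,9]), (12,[2,7,6,0,5,3,9,1,8,4]), (15,[1,5,4,0,8,6,9,3,2,7]),
   (5,[2,7,6,0,3,5,1,8,9,4]), (17,[2,0,7,6,3,1,9,8,5,4]), (5,[3,7,8,0,2,4,1,6,9,5]),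
   (15,[0,3,2,1,7,8,6,5,4,9]), (7,[1,4,5,0,8,9,3,2,6,7]), (1,[4,5,1,6,0,2,3,7,8,9]),
   (9,[1,4,0,5,6,2,3,7,8,9]), (9,[1,4,0,5,6,2,3,7,9,8]), (11,[4,6,1,5,2,7,0,8,9,3]),
   (12,[7,9,8,2,3,6,5,0,4,1]), (11,[4,6,1,5,2,7,0,9,8,3]), (12,[7,8,9,2,3,6,5,0,4,1]),
   (9,[1,4,0,5,7,2,3,6,9,8]), (9,[1,4,0,5,7,2,3,6,8,9]), (1,[4,5,1,7,0,2,3,6,8,9]),
   (11,[4,7,1,5,2,6,0,8,9,3]), (12,[6,9,8,2,3,7,5,0,4,1]), (11,[4,7,1,5,2,6,0,9,8,3]),
   (12,[6,8,9,2,3,7,5,0,4,1]), (11,[4,8,1,5,3,9,0,6,7,2]), (12,[7,9,8,2,3,6,4,0,5,1]),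
   (11,[4,8,1,5,3,9,0,7,6,2]), (12,[6,9,8,2,3,7,4,0,5,1]), (1,[4,5,1,8,0,3,2,9,6,7]),
   (9,[1,4,0,5,8,3,2,9,6,7]), (9,[1,4,0,5,8,3,2,9,7,6]), (11,[4,9,1,5,3,8,0,6,7,2]),
   (12,[7,8,9,2,3,6,4,0,5,1]), (11,[4,9,1,5,3,8,0,7,6,2]), (12,[6,8,9,2,3,7,4,0,5,1]),
   (9,[1,4,0,5,9,3,2,8,7,6]), (9,[1,4,0,5,9,3,2,8,6,7]), (1,[4,5,1,9,0,3,2,8,6,7]),
   (12,[4,6,7,1,2,5,9,0,8,3]), (12,[4,6,7,1,2,5,8,0,9,3]), (12,[4,7,6,1,2,5,9,0,8,3]),
   (12,[4,7,6,1,2,5,8,0,9,3]), (1,[6,7,2,4,0,1,3,5,8,9]), (17,[2,6,7,0,4,8,9,1,3,5]),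
   (17,[2,6,7,0,4,9,8,1,3,5]), (12,[5,6,7,1,2,4,9,0,8,3]), (17,[1,4,5,0,6,8,9,2,3,7]),
   (17,[1,4,5,0,8,6,7,3,2,9]), (9,[2,6,0,7,4,1,3,5,8,9]), (9,[4,6,1,8,2,0,5,3,7,9]),
   (18,[0,1,2,3,4,5,6,7,8,9]), (12,[5,8,9,1,3,4,7,0,6,2]), (12,[5,6,7,1,2,4,8,0,9,3]),
   (17,[1,4,5,0,6,9,8,2,3,7]), (9,[2,6,0,7,4,1,3,5,9,8]), (18,[0,1,2,3,4,5,6,7,9,8]),
   (9,[4,6,1,9,2,0,5,3,7,8]), (17,[1,4,5,0,9,6,7,3,2,8]), (12,[5,9,8,1,3,4,7,0,6,2]),
   (12,[5,7,6,1,2,4,9,0,8,3]), (17,[1,4,5,0,8,7,6,3,2,9]), (9,[2,6,0,7,5,1,3,4,9,8]),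
   (18,[0,1,2,3,4,5,7,6,8,9]), (9,[4,7,1,8,2,0,5,3,6,9]), (17,[1,4,5,0,7,8,9,2,3,6]),
   (12,[5,8,9,1,3,4,6,0,7,2]), (12,[5,7,6,1,2,4,8,0,9,3]), (9,[2,6,0,7,5,1,3,4,8,9]),
   (9,[4,7,1,9,2,0,5,3,6,8]), (18,[0,1,2,3,4,5,7,6,9,8]), (17,[1,4,5,0,9,7,6,3,2,8]),
   (17,[1,4,5,0,7,9,8,2,3,6]), (12,[5,9,8,1,3,4,6,0,7,2]), (1,[6,7,2,5,0,1,3,4,8,9]),
   (17,[2,6,7,0,5,8,9,1,3,4]), (17,[2,6,7,0,5,9,8,1,3,4]), (12,[4,8,9,1,3,5,7,0,6,2]),
   (12,[4,9,8,1,3,5,7,0,6,2]), (12,[4,8,9,1,3,5,6,0,7,2]), (12,[4,9,8,1,3,5,6,0,7,2])]"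

text \<open>Outcomes and relabellings are paired by position, so isomorphisms are only checked,
  never searched for.\<close>

lemma relabellings_complete:
  "list_all2 (\<lambda>(ls, Ks) (c, \<rho>). c < 19 \<and> relabels (fst (cubic_graphs ! c)) \<rho> ls) (levels 3 10 10) relabellings"
  by code_simp

lemma cubic_graphs_valid: "list_all (\<lambda>e. valid_certificate 2048 e \<and> length (fst e) = 10) cubic_graphs"
  by code_simp

text \<open>The threshold 20 is twice the error 10 of one sum. The closest sums with different
  permanents are 30298 (permanent 81) and 30353 (permanent 73), 55 apart.\<close>

lemma cubic_graphs_separated:
  "list_all (\<lambda>(p, x). list_all (\<lambda>(p', x'). p = p' \<or> 20 < \<bar>x - x'\<bar>)
       (map (\<lambda>(C, p, fs). (p, \<Sum>m\<leftarrow>concat (map snd fs). \<bar>m\<bar>)) cubic_graphs))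
     (map (\<lambda>(C, p, fs). (p, \<Sum>m\<leftarrow>concat (map snd fs). \<bar>m\<bar>)) cubic_graphs)"
  by code_simp

section \<open>Transfer from the representatives to arbitrary graphs\<close>

lemma relabels_adjacent_iff:
  assumes rel: "relabels C \<rho> ls" and C: "\<And>k. k < length C \<Longrightarrow> set (C ! k) \<subseteq> {..<length C}"
    and "k < length C" "l < length C"
  shows "\<rho> ! l \<in> set (ls ! (\<rho> ! k)) \<longleftrightarrow> l \<in> set (C ! k)"
proof -
  have "set (ls ! (\<rho> ! k)) = (!) \<rho> ` set (C ! k)"
    using rel assms(3) by (auto simp: relabels_def list_all2_conv_all_nth)
  moreover have "\<rho> ! l = \<rho> ! j \<longleftrightarrow> l = j" if "j \<in> set (C ! k)" for j
    using rel C[OF assms(3)] assms(4) that by (auto simp: relabels_def nth_eq_iff_index_eq)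
  ultimately show ?thesis by auto
qed

lemma (in pair_graph) connected_regular:
  assumes "Digraph_Component.connected (with_proj G)" "regular_graph d G" "pverts G \<noteq> {}"
  shows "connected_regular (pverts G) (\<lambda>v. {w. (v, w) \<in> parcs G}) d"
proof
  show "finite (pverts G)" by (rule pair_finite_verts)
  show "pverts G \<noteq> {}" by fact
  show "{w. (v, w) \<in> parcs G} \<subseteq> pverts G" for v by (auto dest: in_arcsD2)
  show "card {w. (v, w) \<in> parcs G} = d" if "v \<in> pverts G" for v
  proof -
    have "out_arcs (with_proj G) v = Pair v ` {w. (v, w) \<in> parcs G}"
      by (auto simp: out_arcs_def)
    then have "out_degree (with_proj G) v = card {w. (v, w) \<in> parcs G}"
      by (simp add: out_degree_def card_image inj_on_def)
    with assms(2) that show ?thesis by (simp add: regular_graph_def)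
  qed
  show "v \<in> {w'. (w, w') \<in> parcs G}" if "w \<in> {w. (v, w) \<in> parcs G}" for v w
    using that arcs_symmetric by simp
  show "v \<notin> {w. (v, w) \<in> parcs G}" for v using pair_no_loops by fastforce
  show "S = pverts G" if S: "S \<subseteq> pverts G" "S \<noteq> {}" and closed: "\<And>v. v \<in> S \<Longrightarrow> {w. (v, w) \<in> parcs G} \<subseteq> S" for S
  proof -
    \<comment> \<open>Arcs come in opposite pairs, so connectedness gives directed paths, along
      which a closed set propagates.\<close>
    have sc: "strongly_connected (with_proj G)"
      using assms(1) by (intro symmetric_connected_imp_strongly_connected) (simp_all add: pair_sym_arcs)
    obtain u where u: "u \<in> S" using S(2) by blast
    have "v \<in> S" if "v \<in> pverts G" for v
    proof -
      have "u \<rightarrow>\<^sup>*\<^bsub>with_proj G\<^esub> v" using sc u S(1) that by (auto simp: strongly_connected_def)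
      then show "v \<in> S"
        by (induction rule: reachable_induct) (use u closed in auto)
    qed
    with S(1) show ?thesis by blast
  qed
qed

lemma adjacency_mat_reorder:
  assumes "distinct vs" "distinct vs'" "set vs = set vs'"
  obtains p where "p permutes {0..<length vs}"
    and "adjacency_mat vs' G = mat (length vs) (length vs) (\<lambda>(i, j). adjacency_mat vs G $$ (p i, p j))"
proof -
  have len: "length vs' = length vs" using assms by (metis distinct_card)
  have "mset vs' = mset vs" using assms set_eq_iff_mset_eq_distinct by blast
  then obtain p where p: "p permutes {..<length vs}" "permute_list p vs = vs'"
    by (rule mset_eq_permutation)
  have "p i < length vs" if "i < length vs" for i using permutes_in_image[OF p(1), of i] that by simp
  moreover have "vs' ! i = vs ! p i" if "i < length vs" for i
    using p that permute_list_nth by metis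
  ultimately have "adjacency_mat vs' G
      = mat (length vs) (length vs) (\<lambda>(i, j). adjacency_mat vs G $$ (p i, p j))"
    by (auto simp: adjacency_mat_def len)
  with p(1) show ?thesis by (intro that) (simp_all add: atLeast0LessThan)
qed

lemma permanent_adjacency_mat_reorder:
  assumes "distinct vs" "distinct vs'" "set vs = set vs'"
  shows "permanent (adjacency_mat vs' G :: 'a :: {comm_semiring_1} mat) = permanent (adjacency_mat vs G)"
proof -
  obtain p where "p permutes {0..<length vs}"
    and "adjacency_mat vs' G = (mat (length vs) (length vs) (\<lambda>(i, j). adjacency_mat vs G $$ (p i, p j)) :: 'a mat)"
    by (rule adjacency_mat_reorder[OF assms])
  then show ?thesis
    by (simp add: permanent_conjugate_permutation adjacency_mat_def)
qed

lemma graph_energy_reorder: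
  assumes "distinct vs" "distinct vs'" "set vs = set vs'"
  shows "graph_energy vs' G = graph_energy vs G"
proof -
  let ?A = "adjacency_mat vs G :: complex mat" and ?A' = "adjacency_mat vs' G :: complex mat"
  obtain p where "p permutes {0..<length vs}"
    and "?A' = mat (length vs) (length vs) (\<lambda>(i, j). ?A $$ (p i, p j))"
    by (rule adjacency_mat_reorder[OF assms])
  moreover have A: "?A \<in> carrier_mat (length vs) (length vs)" by (simp add: adjacency_mat_def)
  ultimately have "char_poly ?A' = char_poly ?A" by (simp add: char_poly_conjugate_permutation)
  moreover have "?A' \<in> carrier_mat (length vs') (length vs')" by (simp add: adjacency_mat_def)
  ultimately have "eigenvalue ?A' = eigenvalue ?A"
    using A by (intro ext) (simp add: eigenvalue_root_char_poly)
  with \<open>char_poly ?A' = char_poly ?A\<close> show ?thesis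
    unfolding graph_energy_def Let_def by simp
qed

lemma valid_certificate_permanent_energy:
  assumes "valid_certificate N (C, p, fs)" "N > 0"
    and len: "length vs = length C"
    and adj: "\<And>i j. i < length C \<Longrightarrow> j < length C \<Longrightarrow> (vs ! i, vs ! j) \<in> parcs G \<longleftrightarrow> j \<in> set (C ! i)"
  shows "permanent (adjacency_mat vs G :: int mat) = p"
    and "\<bar>N * graph_energy vs G - real_of_int (\<Sum>m\<leftarrow>concat (map snd fs). \<bar>m\<bar>)\<bar> \<le> length C"
proof -
  have cert: "list_all (\<lambda>(i, l). distinct (i # l)) (zip [0..<length C] C)"
    "expand_rows (+) id (permanent_rows C) [([0..<length C], 1)] = [([], p)]"
    "expand_rows list_add (map uminus) (char_poly_rows C) [([0..<length C], [1])]
       = [([], foldr list_mult (map fst fs) [1])]"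
    "list_all (\<lambda>(cs, ms). isolates N cs ms) fs" "length (concat (map snd fs)) = length C"
    using assms(1) by (auto simp: valid_certificate_def list_all_iff)
  have A: "adjacency_mat vs G = (neighbour_mat C :: int mat)"
    and B: "adjacency_mat vs G = (neighbour_mat C :: complex mat)"
    using adj by (auto simp: adjacency_mat_def neighbour_mat_def len)
  have "list_all distinct C" using cert(1) by (auto simp: list_all_length)
  then show "permanent (adjacency_mat vs G :: int mat) = p"
    unfolding A using cert(2) by (rule permanent_neighbour_mat)
  \<comment> \<open>The characteristic polynomial is computed over the integers and carried to the
    complex matrix by the embedding.\<close>
  have "neighbour_mat C = (map_mat of_int (neighbour_mat C) :: complex mat)"
    by (auto simp: neighbour_mat_def)
  moreover have carr: "neighbour_mat C \<in> carrier_mat (length C) (length C)" by (simp add: neighbour_mat_def)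
  ultimately have "char_poly (neighbour_mat C :: complex mat) = of_int_poly (char_poly (neighbour_mat C))"
    using of_int_hom.char_poly_hom[of "neighbour_mat C" "length C"] by (simp add: neighbour_mat_def)
  also have "char_poly (neighbour_mat C :: int mat) = (\<Prod>(cs, ms)\<leftarrow>fs. Poly cs)"
    using char_poly_neighbour_mat[OF cert(1,3)] by (simp add: Poly_foldr_list_mult o_def case_prod_unfold)
  finally have cp: "char_poly (neighbour_mat C :: complex mat) = of_int_poly (\<Prod>(cs, ms)\<leftarrow>fs. Poly cs)" .
  have "(neighbour_mat C :: complex mat) \<in> carrier_mat (length C) (length C)" by (simp add: neighbour_mat_def)
  from energy_approx[OF this cp assms(2) cert(4)] cert(5)
  show "\<bar>N * graph_energy vs G - real_of_int (\<Sum>m\<leftarrow>concat (map snd fs). \<bar>m\<bar>)\<bar> \<le> length C"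
    by (simp add: graph_energy_def Let_def B)
qed

lemma cubic_permanent_energy:
  assumes "pair_graph G" and "Digraph_Component.connected (with_proj G)" and "regular_graph 3 G"
    and "card (pverts G) = 10" and "distinct vs" and "set vs = pverts G"
  obtains C p fs where "(C, p, fs) \<in> set cubic_graphs"
    and "permanent (adjacency_mat vs G :: int mat) = p"
    and "\<bar>2048 * graph_energy vs G - real_of_int (\<Sum>m\<leftarrow>concat (map snd fs). \<bar>m\<bar>)\<bar> \<le> 10"
proof -
  interpret pair_graph G by fact
  interpret connected_regular "pverts G" "\<lambda>v. {w. (v, w) \<in> parcs G}" 3
    using assms by (intro connected_regular) auto
  obtain us ls Ks where leaf: "(ls, Ks) \<in> set (levels 3 10 10)"
    and us: "distinct us" "set us = pverts G"
    and adj: "\<And>k l. k < 10 \<Longrightarrow> l < 10 \<Longrightarrow> us ! l \<in> {w. (us ! k, w) \<in> parcs G} \<longleftrightarrow> l \<in> set (ls ! k)"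
    using levels_complete unfolding assms(4) by metis
  obtain c \<rho> where c: "c < 19" and rel: "relabels (fst (cubic_graphs ! c)) \<rho> ls"
    using relabellings_complete leaf unfolding list_all2_conv_all_nth in_set_conv_nth by fastforce
  obtain C p fs where e: "cubic_graphs ! c = (C, p, fs)" by (cases "cubic_graphs ! c")
  have "length cubic_graphs = 19" by (simp add: cubic_graphs_def)
  then have mem: "(C, p, fs) \<in> set cubic_graphs" using c e nth_mem by metis
  then have cert: "valid_certificate 2048 (C, p, fs)" and len: "length C = 10"
    using cubic_graphs_valid by (auto simp: list_all_iff)
  have C: "set (C ! k) \<subseteq> {..<length C}" if "k < length C" for k
  proof -
    have "list_all (\<lambda>j. j < length C) (C ! k)"
      using cert that by (auto simp: valid_certificate_def list_all_length)
    then show ?thesis by (auto simp: list_all_iff)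
  qed
  \<comment> \<open>Since \<open>\<rho>\<close> sends vertices of the representative to discovery
    numbers and \<open>us\<close> sends these to vertices of \<open>G\<close>, the enumeration
    \<open>ws\<close> gives \<open>G\<close> exactly the neighbour lists \<open>C\<close>.\<close>
  define ws where "ws = map ((!) us) \<rho>"
  have \<rho>: "distinct \<rho>" "length \<rho> = 10" "set \<rho> \<subseteq> {..<10}"
    using rel by (auto simp: relabels_def e len list_all_iff)
  have "length us = 10" using us assms(4) by (metis distinct_card)
  have ws: "distinct ws"
    using us(1) \<rho> \<open>length us = 10\<close>
    by (auto simp: ws_def distinct_map inj_on_def nth_eq_iff_index_eq subset_iff)
  have "set ws \<subseteq> pverts G"
    using \<rho>(3) \<open>length us = 10\<close> us(2) by (force simp: ws_def)
  then have set_ws: "set vs = set ws"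
    using card_subset_eq[OF pair_finite_verts, of "set ws"] distinct_card[OF ws] \<rho>(2) assms(4,6)
    by (simp add: ws_def)
  have "(ws ! i, ws ! j) \<in> parcs G \<longleftrightarrow> j \<in> set (C ! i)" if "i < length C" "j < length C" for i j
  proof -
    have "\<rho> ! i < 10" "\<rho> ! j < 10" using \<rho> that len nth_mem by (metis lessThan_iff subset_iff)+
    then show ?thesis
      using relabels_adjacent_iff[OF rel[unfolded e fst_conv] C that] adj that len \<rho>(2)
      by (simp add: ws_def)
  qed
  moreover have "length ws = length C" by (simp add: ws_def \<rho>(2) len)
  ultimately have perm: "permanent (adjacency_mat ws G :: int mat) = p"
    and energy: "\<bar>2048 * graph_energy ws G - real_of_int (\<Sum>m\<leftarrow>concat (map snd fs). \<bar>m\<bar>)\<bar> \<le> 10"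
    using valid_certificate_permanent_energy[OF cert, of ws G] len by simp_all
  show ?thesis
  proof (rule that[OF mem])
    show "permanent (adjacency_mat vs G :: int mat) = p"
      using perm unfolding permanent_adjacency_mat_reorder[OF assms(5) ws set_ws] .
    show "\<bar>2048 * graph_energy vs G - real_of_int (\<Sum>m\<leftarrow>concat (map snd fs). \<bar>m\<bar>)\<bar> \<le> 10"
      using energy unfolding graph_energy_reorder[OF assms(5) ws set_ws] .
  qed
qed

theorem theorem2p6:
  fixes G :: "'a pair_pre_digraph" and H :: "'b pair_pre_digraph"
    and vs :: "'a list" and ws :: "'b list"
  assumes "pair_graph G" and "pair_graph H"
    and "Digraph_Component.connected (with_proj G)" and "Digraph_Component.connected (with_proj H)"
    and "regular_graph 3 G" and "regular_graph 3 H"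
    and "card (pverts G) = 10" and "card (pverts H) = 10"
    and "distinct vs" and "set vs = pverts G"
    and "distinct ws" and "set ws = pverts H"
    and "graph_energy vs G = graph_energy ws H"
  shows "permanent (adjacency_mat vs G :: int mat) = permanent (adjacency_mat ws H)"
proof -
  let ?s = "\<lambda>fs :: (int list \<times> int list) list. \<Sum>m\<leftarrow>concat (map snd fs). \<bar>m\<bar>"
  obtain C p fs where G: "(C, p, fs) \<in> set cubic_graphs" "permanent (adjacency_mat vs G :: int mat) = p"
    "\<bar>2048 * graph_energy vs G - real_of_int (?s fs)\<bar> \<le> 10"
    by (rule cubic_permanent_energy[OF assms(1,3,5,7,9,10)])
  obtain C' p' fs' where H: "(C', p', fs') \<in> set cubic_graphs" "permanent (adjacency_mat ws H :: int mat) = p'"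
    "\<bar>2048 * graph_energy ws H - real_of_int (?s fs')\<bar> \<le> 10"
    by (rule cubic_permanent_energy[OF assms(2,4,6,8,11,12)])
  \<comment> \<open>The equal energies cancel, leaving the two errors of at most 10 each.\<close>
  have "\<bar>real_of_int (?s fs) - real_of_int (?s fs')\<bar> \<le> 20"
    using G(3) H(3) assms(13) by linarith
  then have "\<bar>?s fs - ?s fs'\<bar> \<le> 20" by linarith
  moreover have "p = p' \<or> 20 < \<bar>?s fs - ?s fs'\<bar>"
    using cubic_graphs_separated G(1) H(1) by (fastforce simp: list_all_iff)
  ultimately show ?thesis using G(2) H(2) by auto
qed

end
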